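(* It is decidable whether, for given topologically transitive sofic systems $X\subset\Sigma^{\mathbb Z}$ and $\widetilde X\subset\widetilde\Sigma^{\mathbb Z}$, there exists a homomorphism $\varphi:X\to\widetilde X$. That is, there is an algorithm which, given as input finite presentations of two topologically transitive sofic systems $X$ and $\widetilde X$, always halts and correctly answers whether there exists a homomorphism from $X$ to $\widetilde X$.
   Context: $\Sigma$ and $\widetilde\Sigma$ are finite alphabets. A subshift is a closed subset $X$ of $\Sigma^{\mathbb Z}$ invariant under the shift $S((x_i)_{i\in\mathbb Z})=(x_{i+1})_{i\in\mathbb Z}$, together with the restriction $S_X$ of the shift to $X$. A homomorphism from a subshift $X\subset\Sigma^{\mathbb Z}$ to a subshift $\widetilde X\subset\widetilde\Sigma^{\mathbb Z}$ is a continuous shift-commuting map from $X$ into $\widetilde X$ (not necessarily surjective). A subshift of finite type is a subshift obtained by excluding a finite set of words from a shift space; sofic systems are the homomorphic images of subshifts of finite type. Equivalently, a sofic system is the set of bi-infinite label sequences of bi-infinite paths in a finite directed graph with edges labelled by symbols of $\Sigma$; such a finite labelled graph is a finite presentation of $X$. Topological transitivity of $X$ means that for all admissible words $u,v$ of $X$ there is a word $w$ such that $uwv$ is admissible for $X$. *)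

theory Defs
  imports "HOL-Analysis.Analysis" "HOL-Library.Nat_Bijection"
begin

section \<open>Subshifts\<close>

text \<open>
  A point of \<open>A\<^sup>\<int>\<close> is a function on \<^typ>\<open>int\<close> with range in the finite set \<open>A\<close>.  The symbol
  type carries the discrete topology, so the topology of the function type is the product topology
  and induces the usual one on \<open>A\<^sup>\<int>\<close>, a closed set.  The empty subshift is allowed.
\<close>

definition shift :: "(int \<Rightarrow> 'a) \<Rightarrow> int \<Rightarrow> 'a" where
  "shift x = (\<lambda>i. x (i + 1))"

definition subshift :: "'a::discrete_topology set \<Rightarrow> (int \<Rightarrow> 'a) set \<Rightarrow> bool" where
  "subshift A X \<longleftrightarrow> finite A \<and> (\<forall>x\<in>X. range x \<subseteq> A) \<and> closed X \<and> shift ` X = X"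

definition homomorphism ::
  "(int \<Rightarrow> 'a::discrete_topology) set \<Rightarrow> (int \<Rightarrow> 'b::discrete_topology) set \<Rightarrow>
   ((int \<Rightarrow> 'a) \<Rightarrow> (int \<Rightarrow> 'b)) \<Rightarrow> bool" where
  "homomorphism X Y \<phi> \<longleftrightarrow>
     continuous_on X \<phi> \<and> \<phi> ` X \<subseteq> Y \<and> (\<forall>x\<in>X. \<phi> (shift x) = shift (\<phi> x))"

definition occurs_in :: "'a list \<Rightarrow> (int \<Rightarrow> 'a) \<Rightarrow> bool" where
  "occurs_in w x \<longleftrightarrow> (\<exists>i. \<forall>k<length w. x (i + int k) = w ! k)"

definition admissible :: "(int \<Rightarrow> 'a) set \<Rightarrow> 'a list \<Rightarrow> bool" where
  "admissible X w \<longleftrightarrow> (\<exists>x\<in>X. occurs_in w x)"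

definition topologically_transitive :: "(int \<Rightarrow> 'a) set \<Rightarrow> bool" where
  "topologically_transitive X \<longleftrightarrow>
     (\<forall>u v. admissible X u \<longrightarrow> admissible X v \<longrightarrow> (\<exists>w. admissible X (u @ w @ v)))"

definition subshift_of_finite_type :: "'a set \<Rightarrow> (int \<Rightarrow> 'a) set \<Rightarrow> bool" where
  "subshift_of_finite_type A X \<longleftrightarrow>
     finite A \<and> (\<exists>F. finite F \<and> X = {x. range x \<subseteq> A \<and> (\<forall>w\<in>F. \<not> occurs_in w x)})"

text \<open>
  Any finite alphabet can be renamed to a set of natural numbers, so the subshift of finite type
  in the next definition may be taken over such an alphabet.
\<close>

definition sofic :: "'a::discrete_topology set \<Rightarrow> (int \<Rightarrow> 'a) set \<Rightarrow> bool" where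
  "sofic A X \<longleftrightarrow> subshift A X \<and>
     (\<exists>(B :: nat set) Y \<phi>. subshift_of_finite_type B Y \<and> homomorphism Y X \<phi> \<and> \<phi> ` Y = X)"


section \<open>Finite presentations\<close>

text \<open>
  A finite labelled graph is given by the list of its edges (source, label, target).  Isolated
  vertices and repeated edges with the same label do not affect the label sequences.
\<close>

type_synonym 'a labelled_graph = "(nat \<times> 'a \<times> nat) list"

definition label_sequences :: "'a labelled_graph \<Rightarrow> (int \<Rightarrow> 'a) set" where
  "label_sequences G = {x. \<exists>v. \<forall>i. (v i, x i, v (i + 1)) \<in> set G}"

definition finite_presentation :: "'a set \<Rightarrow> 'a labelled_graph \<Rightarrow> (int \<Rightarrow> 'a) set \<Rightarrow> bool" where
  "finite_presentation A G X \<longleftrightarrow> (\<forall>(p, a, q)\<in>set G. a \<in> A) \<and> X = label_sequences G"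

definition edge_encode :: "nat \<times> nat \<times> nat \<Rightarrow> nat" where
  "edge_encode = (\<lambda>(p, a, q). prod_encode (p, prod_encode (a, q)))"

definition graph_encode :: "nat labelled_graph \<Rightarrow> nat" where
  "graph_encode G = list_encode (map edge_encode G)"


section \<open>Algorithms\<close>

text \<open>
  The model of computation is that of partial recursive functions, as programs with a big-step
  semantics: \<open>computes f xs y\<close> says that \<open>f\<close> halts on the arguments \<open>xs\<close> with result \<open>y\<close>.
\<close>

datatype recf =
    Zero
  | Succ
  | Proj nat
  | Comp recf "recf list"
  | PrimRec recf recf
  | Mu recf

inductive computes :: "recf \<Rightarrow> nat list \<Rightarrow> nat \<Rightarrow> bool" where
  "computes Zero xs 0"
| "computes Succ [x] (Suc x)"
| "i < length xs \<Longrightarrow> computes (Proj i) xs (xs ! i)"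
| "list_all2 (\<lambda>g y. computes g xs y) gs ys \<Longrightarrow> computes f ys z \<Longrightarrow> computes (Comp f gs) xs z"
| "computes f xs y \<Longrightarrow> computes (PrimRec f g) (0 # xs) y"
| "computes (PrimRec f g) (n # xs) y \<Longrightarrow> computes g (n # y # xs) z \<Longrightarrow>
     computes (PrimRec f g) (Suc n # xs) z"
| "computes f (y # xs) 0 \<Longrightarrow> (\<forall>z<y. \<exists>v. computes f (z # xs) (Suc v)) \<Longrightarrow> computes (Mu f) xs y"

inductive_cases computes_ZeroE: "computes Zero xs y"
inductive_cases computes_SuccE: "computes Succ xs y"
inductive_cases computes_ProjE: "computes (Proj i) xs y"
inductive_cases computes_CompE: "computes (Comp f gs) xs y"
inductive_cases computes_PrimRec_0E: "computes (PrimRec f g) (0 # xs) y"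
inductive_cases computes_PrimRec_SucE: "computes (PrimRec f g) (Suc n # xs) y"
inductive_cases computes_MuE: "computes (Mu f) xs y"

lemma computes_deterministic:
  "computes f xs y \<Longrightarrow> computes f xs z \<Longrightarrow> y = z"
proof (induction arbitrary: z rule: computes.induct)
  case (1 xs)
  then show ?case by (elim computes_ZeroE) simp
next
  case (2 x)
  then show ?case by (elim computes_SuccE) simp
next
  case (3 i xs)
  from "3.prems" show ?case by (elim computes_ProjE) simp
next
  case (4 xs gs ys f z')
  from "4.prems" obtain ys' where ys': "list_all2 (\<lambda>g y. computes g xs y) gs ys'" "computes f ys' z"
    by (rule computes_CompE)
  have "ys = ys'"
    using "4.IH"(1) ys'(1) unfolding list_all2_conv_all_nth by (intro nth_equalityI) simp_all
  with ys'(2) have "computes f ys z" by simp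
  then show ?case by (rule "4.IH"(2))
next
  case (5 f xs y g)
  from "5.prems" have "computes f xs z" by (rule computes_PrimRec_0E)
  then show ?case by (rule "5.IH")
next
  case (6 f g n xs y z')
  from "6.prems" obtain u where u: "computes (PrimRec f g) (n # xs) u" "computes g (n # u # xs) z"
    by (rule computes_PrimRec_SucE)
  have "y = u" using u(1) by (rule "6.IH"(1))
  with u(2) have "computes g (n # y # xs) z" by simp
  then show ?case by (rule "6.IH"(2))
next
  case (7 f y xs)
  have z: "computes f (z # xs) 0 \<and> (\<forall>u<z. \<exists>v. computes f (u # xs) (Suc v))"
    using "7.prems" by (rule computes_MuE) (intro conjI)
  show ?case
  proof (rule linorder_cases[of y z])
    assume "y < z"
    then obtain v where "computes f (y # xs) (Suc v)" using z by blast
    then have "0 = Suc v" by (rule "7.IH"(1))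
    then show ?thesis by simp
  next
    assume "z < y"
    have "\<exists>v. computes f (z # xs) (Suc v) \<and> (\<forall>r. computes f (z # xs) r \<longrightarrow> Suc v = r)"
      by (rule "7.IH"(2)[rule_format, OF \<open>z < y\<close>])
    then obtain v where "\<forall>r. computes f (z # xs) r \<longrightarrow> Suc v = r" by (elim exE conjE)
    from this[rule_format, OF conjunct1[OF z]] show ?thesis by simp
  qed simp
qed


section \<open>Finite presentations present sofic systems\<close>

lemma inj_edge_encode: "inj edge_encode"
  by (auto simp: inj_on_def edge_encode_def)

lemma closed_occurrence_free:
  "closed {x :: int \<Rightarrow> 'a::discrete_topology. \<not> occurs_in w x}"
proof -
  have "{x :: int \<Rightarrow> 'a. occurs_in w x} = (\<Union>i. \<Inter>k\<in>{..<length w}. (\<lambda>x. x (i + int k)) -` {w ! k})"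
    by (auto simp: occurs_in_def)
  moreover have "open ((\<lambda>x :: int \<Rightarrow> 'a. x j) -` {a})" for j a
    by (rule open_vimage) (auto simp: open_discrete continuous_on_product_coordinates)
  ultimately have "open {x :: int \<Rightarrow> 'a. occurs_in w x}"
    by (auto intro!: open_UN open_INT)
  then show ?thesis by (simp add: closed_def Collect_neg_eq[symmetric])
qed

lemma compact_full_shift:
  assumes "finite A"
  shows "compact {x :: int \<Rightarrow> 'a::discrete_topology. range x \<subseteq> A}"
proof -
  have "{x :: int \<Rightarrow> 'a. range x \<subseteq> A} = PiE UNIV (\<lambda>_. A)" by (auto simp: PiE_def)
  moreover have "compactin (product_topology (\<lambda>_. euclidean) UNIV) (PiE (UNIV :: int set) (\<lambda>_. A))"
    unfolding compactin_PiE using assms by (simp add: finite_imp_compact)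
  ultimately show ?thesis
    by (metis compactin_euclidean_iff euclidean_product_topology)
qed

lemma closed_if_compact:
  fixes X :: "(int \<Rightarrow> 'a::discrete_topology) set"
  assumes "compact X"
  shows "closed X"
proof -
  have "Hausdorff_space (euclidean :: 'a topology)"
    using hausdorff unfolding Hausdorff_space_def disjnt_def open_openin[symmetric] by blast
  then have "Hausdorff_space (product_topology (\<lambda>_. euclidean :: 'a topology) (UNIV :: int set))"
    by (simp add: Hausdorff_space_product_topology)
  then have "Hausdorff_space (euclidean :: (int \<Rightarrow> 'a) topology)"
    by (simp only: euclidean_product_topology)
  then have "closedin euclidean X"
    using assms by (intro compactin_imp_closedin) simp_all
  then show ?thesis by simp
qed

lemma compact_subshift_of_finite_type:
  fixes X :: "(int \<Rightarrow> 'a::discrete_topology) set"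
  assumes "subshift_of_finite_type A X"
  shows "compact X"
proof -
  obtain F where F: "finite A" "X = {x. range x \<subseteq> A \<and> (\<forall>w\<in>F. \<not> occurs_in w x)}"
    using assms by (auto simp: subshift_of_finite_type_def)
  have "X = {x. range x \<subseteq> A} \<inter> (\<Inter>w\<in>F. {x. \<not> occurs_in w x})" using F by auto
  then show ?thesis
    using compact_full_shift[OF F(1)] closed_occurrence_free by (auto intro!: compact_Int_closed)
qed

lemma shift_label_sequences: "shift ` label_sequences G = label_sequences G"
proof
  show "shift ` label_sequences G \<subseteq> label_sequences G"
  proof clarify
    fix x assume "x \<in> label_sequences G"
    then obtain v where v: "\<And>i. (v i, x i, v (i + 1)) \<in> set G" by (auto simp: label_sequences_def)
    have "\<forall>i. (v (i + 1), x (i + 1), v (i + 1 + 1)) \<in> set G" using v by blast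
    then show "shift x \<in> label_sequences G"
      unfolding label_sequences_def shift_def mem_Collect_eq
      by (intro exI[of _ "\<lambda>i. v (i + 1)"])
  qed
  show "label_sequences G \<subseteq> shift ` label_sequences G"
  proof
    fix x assume "x \<in> label_sequences G"
    then obtain v where v: "\<And>i. (v i, x i, v (i + 1)) \<in> set G" by (auto simp: label_sequences_def)
    have "(v (i - 1), x (i - 1), v (i + 1 - 1)) \<in> set G" for i
      using v[of "i - 1"] by simp
    then have "(\<lambda>i. x (i - 1)) \<in> label_sequences G"
      unfolding label_sequences_def mem_Collect_eq
      by (intro exI[of _ "\<lambda>i. v (i - 1)"] allI)
    moreover have "x = shift (\<lambda>i. x (i - 1))" by (simp add: shift_def)
    ultimately show "x \<in> shift ` label_sequences G" by blast
  qed
qed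

theorem finite_presentation_imp_sofic:
  fixes X :: "(int \<Rightarrow> nat) set"
  assumes A: "finite A" and pres: "finite_presentation A G X"
  shows "sofic A X"
proof -
  have X: "X = label_sequences G" and labels: "\<And>p a q. (p, a, q) \<in> set G \<Longrightarrow> a \<in> A"
    using pres by (auto simp: finite_presentation_def)
  define B where "B = edge_encode ` set G"
  define F where "F = (\<lambda>(e, e'). [edge_encode e, edge_encode e']) `
    {(e, e') \<in> set G \<times> set G. snd (snd e) \<noteq> fst e'}"
  define Y where "Y = {y. range y \<subseteq> B \<and> (\<forall>w\<in>F. \<not> occurs_in w y)}"
  define dec where "dec = inv edge_encode"
  define \<phi> :: "(int \<Rightarrow> nat) \<Rightarrow> int \<Rightarrow> nat" where "\<phi> y = (\<lambda>i. fst (snd (dec (y i))))" for y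
  have dec: "dec (edge_encode e) = e" for e
    by (simp add: dec_def inj_edge_encode)
  have "finite {(e, e') \<in> set G \<times> set G. snd (snd e) \<noteq> fst e'}"
    by (rule finite_subset[of _ "set G \<times> set G"]) auto
  then have "finite F" unfolding F_def by (rule finite_imageI)
  then have sft: "subshift_of_finite_type B Y"
    unfolding subshift_of_finite_type_def Y_def by (intro conjI exI[of _ F]) (simp_all add: B_def)
  have cont: "continuous_on S \<phi>" for S
  proof (rule continuous_on_coordinatewise_then_product)
    fix i
    have "continuous_on S ((\<lambda>n. fst (snd (dec n))) \<circ> (\<lambda>y. y i))"
      by (rule continuous_on_compose) (auto intro: continuous_on_subset[OF continuous_on_product_coordinates] continuous_on_discrete)
    then show "continuous_on S (\<lambda>y. \<phi> y i)" by (simp add: \<phi>_def comp_def)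
  qed
  have im1: "\<phi> y \<in> X" if y: "y \<in> Y" for y
  proof -
    have e: "dec (y i) \<in> set G" "y i = edge_encode (dec (y i))" for i
    proof -
      have "y i \<in> B" using y by (auto simp: Y_def)
      then show "dec (y i) \<in> set G" "y i = edge_encode (dec (y i))" by (auto simp: B_def dec)
    qed
    have link: "snd (snd (dec (y i))) = fst (dec (y (i + 1)))" for i
    proof (rule ccontr)
      assume "snd (snd (dec (y i))) \<noteq> fst (dec (y (i + 1)))"
      then have "[y i, y (i + 1)] \<in> F"
        unfolding F_def using e(1)[of i] e(1)[of "i + 1"] e(2)[of i] e(2)[of "i + 1"]
        by (intro image_eqI[of _ _ "(dec (y i), dec (y (i + 1)))"]) simp_all
      moreover have "occurs_in [y i, y (i + 1)] y"
        unfolding occurs_in_def by (rule exI[of _ i]) (auto simp: less_Suc_eq)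
      ultimately show False using y by (auto simp: Y_def)
    qed
    have "(fst (dec (y i)), \<phi> y i, fst (dec (y (i + 1)))) \<in> set G" for i
      using e(1)[of i] unfolding link[symmetric] \<phi>_def by simp
    then show ?thesis
      unfolding X label_sequences_def mem_Collect_eq by (intro exI[of _ "\<lambda>i. fst (dec (y i))"]) auto
  qed
  have im2: "x \<in> \<phi> ` Y" if x: "x \<in> X" for x
  proof -
    obtain v where v: "\<And>i. (v i, x i, v (i + 1)) \<in> set G"
      using x by (auto simp: X label_sequences_def)
    define y where "y i = edge_encode (v i, x i, v (i + 1))" for i
    have "\<not> occurs_in w y" if w: "w \<in> F" for w
    proof
      assume "occurs_in w y"
      then obtain i where i: "\<And>k. k < length w \<Longrightarrow> y (i + int k) = w ! k"
        by (auto simp: occurs_in_def)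
      obtain e e' where w: "w = [edge_encode e, edge_encode e']" "snd (snd e) \<noteq> fst e'"
        using w by (auto simp: F_def)
      have "dec (y i) = e" "dec (y (i + 1)) = e'"
        using i[of 0] i[of 1] w by (auto simp: dec)
      then show False using w(2) by (auto simp: y_def dec)
    qed
    then have "y \<in> Y" using v by (auto simp: Y_def B_def y_def)
    moreover have "x = \<phi> y" by (simp add: \<phi>_def y_def dec)
    ultimately show ?thesis by blast
  qed
  have im: "\<phi> ` Y = X" using im1 im2 by blast
  have hom: "homomorphism Y X \<phi>"
    unfolding homomorphism_def using cont im by (auto simp: \<phi>_def shift_def)
  have "compact X"
    using compact_continuous_image[OF cont compact_subshift_of_finite_type[OF sft]] im by simp
  then have "closed X" by (rule closed_if_compact)
  moreover have "range x \<subseteq> A" if "x \<in> X" for x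
    using that labels by (auto simp: X label_sequences_def)
  ultimately have "subshift A X"
    using A shift_label_sequences unfolding subshift_def X by blast
  then show ?thesis using sft hom im unfolding sofic_def by blast
qed

end

theory Submission
  imports Defs
begin

text \<open>
  Let the labelled graphs \<open>G\<close> and \<open>H\<close> present the two systems.  The heart of the matter is that the
  existence of some homomorphism implies the existence of one whose coding radius is bounded by an
  explicit function of the numbers of vertices and labels (\<open>bounded_radius\<close>).  A search through the
  finitely many block codes of that radius then settles the question.

  The type of a word is the relation on vertices given by the paths that it labels.  A label sequence
  stays one when a factor is replaced by another factor of the same type, and there are only finitely
  many types.  Given a homomorphism \<open>\<phi>\<close> of unknown radius \<open>R\<close>, a point \<open>x\<close> is cut into pieces at
  positions that are recognized locally, with a radius that does not depend on \<open>R\<close>: markers as in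
  Krieger's marker lemma, at mutual distance at least \<open>N\<close>, and all positions far from every marker,
  around which \<open>x\<close> looks periodic with a period below \<open>N\<close>.  Each piece of length at least \<open>N\<close> is pumped
  up to a word of the same type and of length at least \<open>R\<close>.  The pumped point \<open>x'\<close> is again a label
  sequence of \<open>G\<close>, and the part of \<open>\<phi> x'\<close> over a pumped piece is determined by \<open>x\<close> near the original
  piece.  This part is then shrunk back to the original length without changing its type with respect
  to \<open>H\<close>; for this, the length added by pumping must be a multiple of a suitable factorial
  (\<open>shrink_word\<close>).  The shrunk outputs fit together to a label sequence of \<open>H\<close> (\<open>psi_into\<close>), and the map
  that sends \<open>x\<close> to it has a radius in which \<open>R\<close> does not occur (\<open>psi_local\<close>).

  For a given block code, whether it maps the first system into the second can be tested on paths of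
  bounded length by the usual cut-and-splice argument on a finite automaton (\<open>block_ok_if_short\<close>).
  Coding words and block codes by the digits of numbers turns the whole criterion into a formula in
  which all quantifiers are bounded by elementary functions (\<open>homomorphism_iff_table\<close>).  Such formulas
  are evaluated by terms built from arithmetic, bounded sums and bounded products, and these compile to
  partial recursive programs (\<open>computable_ev\<close>).
\<close>

section \<open>Elementary functions are computable\<close>

text \<open>
  Terms for the elementary functions of Kalmar.  Variables are de Bruijn indices into the argument
  list; \<open>Sum\<close> and \<open>Prod\<close> bind the summation index as variable \<open>0\<close>.  On truth values, with \<open>0\<close> as
  falsehood, they are the bounded existential and universal quantifiers.  \<open>Call\<close> starts a fresh
  environment, so that closed terms can be reused below binders without shifting indices.
\<close>

datatype etm = Var nat | Num nat | Add etm etm | Sub etm etm | Mul etm etm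
  | Sum etm etm | Prod etm etm | Call etm "etm list"

fun ev :: "etm \<Rightarrow> nat list \<Rightarrow> nat" where
  "ev (Var i) xs = xs ! i"
| "ev (Num c) xs = c"
| "ev (Add s t) xs = ev s xs + ev t xs"
| "ev (Sub s t) xs = ev s xs - ev t xs"
| "ev (Mul s t) xs = ev s xs * ev t xs"
| "ev (Sum b t) xs = (\<Sum>k<ev b xs. ev t (k # xs))"
| "ev (Prod b t) xs = (\<Prod>k<ev b xs. ev t (k # xs))"
| "ev (Call t ts) xs = ev t (map (\<lambda>s. ev s xs) ts)"

fun wf_etm :: "nat \<Rightarrow> etm \<Rightarrow> bool" where
  "wf_etm n (Var i) = (i < n)"
| "wf_etm n (Num c) = True"
| "wf_etm n (Add s t) = (wf_etm n s \<and> wf_etm n t)"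
| "wf_etm n (Sub s t) = (wf_etm n s \<and> wf_etm n t)"
| "wf_etm n (Mul s t) = (wf_etm n s \<and> wf_etm n t)"
| "wf_etm n (Sum b t) = (wf_etm n b \<and> wf_etm (Suc n) t)"
| "wf_etm n (Prod b t) = (wf_etm n b \<and> wf_etm (Suc n) t)"
| "wf_etm n (Call t ts) = (wf_etm (length ts) t \<and> list_all (wf_etm n) ts)"

definition computable :: "nat \<Rightarrow> (nat list \<Rightarrow> nat) \<Rightarrow> bool" where
  "computable n F \<longleftrightarrow> (\<exists>p. \<forall>xs. length xs = n \<longrightarrow> computes p xs (F xs))"

lemma computable_proj: "i < n \<Longrightarrow> computable n (\<lambda>xs. xs ! i)"
  unfolding computable_def by (intro exI[of _ "Proj i"]) (auto intro: computes.intros)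

lemma computable_const: "computable n (\<lambda>xs. c)"
proof (induction c)
  case 0
  show ?case unfolding computable_def by (intro exI[of _ Zero]) (auto intro: computes.intros)
next
  case (Suc c)
  then obtain p where "\<forall>xs. length xs = n \<longrightarrow> computes p xs c" by (auto simp: computable_def)
  then show ?case unfolding computable_def
    by (intro exI[of _ "Comp Succ [p]"]) (auto intro!: computes.intros(4)[of _ _ "[c]"] computes.intros(2))
qed

lemma computable_comp:
  assumes F: "computable (length Gs) F" and Gs: "list_all (computable n) Gs"
  shows "computable n (\<lambda>xs. F (map (\<lambda>g. g xs) Gs))"
proof -
  obtain p where p: "\<And>xs. length xs = length Gs \<Longrightarrow> computes p xs (F xs)"
    using F by (auto simp: computable_def)
  have "\<forall>g\<in>set Gs. \<exists>r. \<forall>xs. length xs = n \<longrightarrow> computes r xs (g xs)"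
    using Gs by (auto simp: computable_def list_all_iff)
  then obtain r where r: "\<And>g xs. g \<in> set Gs \<Longrightarrow> length xs = n \<Longrightarrow> computes (r g) xs (g xs)"
    by metis
  have "computes (Comp p (map r Gs)) xs (F (map (\<lambda>g. g xs) Gs))" if "length xs = n" for xs
    by (rule computes.intros(4)[of _ _ "map (\<lambda>g. g xs) Gs"])
      (auto simp: list_all2_conv_all_nth that intro: r p)
  then show ?thesis unfolding computable_def by blast
qed

lemma computable_comp2:
  assumes "computable 2 (\<lambda>xs. f (xs ! 0) (xs ! 1))" "computable n F" "computable n G"
  shows "computable n (\<lambda>xs. f (F xs) (G xs))"
  using computable_comp[of "[F, G]" "\<lambda>xs. f (xs ! 0) (xs ! 1)" n] assms
  by (simp add: numeral_2_eq_2)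

lemma computable_primrec:
  assumes F: "computable n F" and G: "computable (Suc (Suc n)) G"
  shows "computable (Suc n) (\<lambda>xs. rec_nat (F (tl xs)) (\<lambda>k y. G (k # y # tl xs)) (hd xs))"
proof -
  obtain p where p: "\<And>xs. length xs = n \<Longrightarrow> computes p xs (F xs)"
    using F by (auto simp: computable_def)
  obtain r where r: "\<And>xs. length xs = Suc (Suc n) \<Longrightarrow> computes r xs (G xs)"
    using G by (auto simp: computable_def)
  have "computes (PrimRec p r) (k # xs) (rec_nat (F xs) (\<lambda>k y. G (k # y # xs)) k)"
    if "length xs = n" for k xs
    by (induction k) (auto intro!: computes.intros(5) computes.intros(6)[OF _ r] p simp: that)
  then have "computes (PrimRec p r) xs (rec_nat (F (tl xs)) (\<lambda>k y. G (k # y # tl xs)) (hd xs))"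
    if "length xs = Suc n" for xs
    using that by (cases xs) auto
  then show ?thesis unfolding computable_def by blast
qed

lemma computable_cong:
  assumes "\<And>xs. length xs = n \<Longrightarrow> F xs = G xs"
  shows "computable n F = computable n G"
  unfolding computable_def using assms by (metis (lifting))

lemma computable_Suc: "computable n F \<Longrightarrow> computable n (\<lambda>xs. Suc (F xs))"
proof -
  assume F: "computable n F"
  have "computable 1 (\<lambda>xs. Suc (xs ! 0))"
    unfolding computable_def by (intro exI[of _ Succ]) (auto simp: length_Suc_conv intro: computes.intros)
  from computable_comp[of "[F]", OF _ , of "\<lambda>xs. Suc (xs ! 0)" n] this F show ?thesis by simp
qed

lemma computable_add: "computable 2 (\<lambda>xs. xs ! 0 + xs ! 1)"
proof -
  have "computable (Suc 1) (\<lambda>xs. rec_nat ((tl xs) ! 0) (\<lambda>k y. Suc ((k # y # tl xs) ! 1)) (hd xs))"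
    by (intro computable_primrec computable_Suc computable_proj) simp_all
  moreover have "rec_nat a (\<lambda>k y. Suc y) b = b + a" for a b by (induction b) auto
  ultimately show ?thesis
    by (subst computable_cong[where G = "\<lambda>xs. rec_nat ((tl xs) ! 0) (\<lambda>k y. Suc ((k # y # tl xs) ! 1)) (hd xs)"])
      (auto simp: numeral_2_eq_2 length_Suc_conv)
qed

lemma computable_pred: "computable n F \<Longrightarrow> computable n (\<lambda>xs. F xs - 1)"
proof -
  assume F: "computable n F"
  have "computable (Suc 0) (\<lambda>xs. rec_nat ((\<lambda>xs. 0) (tl xs)) (\<lambda>k y. (k # y # tl xs) ! 0) (hd xs))"
    by (intro computable_primrec computable_const computable_proj) simp_all
  moreover have "rec_nat 0 (\<lambda>k y. k) b = b - 1" for b :: nat by (cases b) auto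
  ultimately have "computable (Suc 0) (\<lambda>xs. hd xs - 1)" by simp
  from computable_comp[of "[F]", OF _ , of "\<lambda>xs. hd xs - 1" n] this F show ?thesis by simp
qed

lemma computable_sub: "computable 2 (\<lambda>xs. xs ! 0 - xs ! 1)"
proof -
  have "computable (Suc 1) (\<lambda>xs. rec_nat ((tl xs) ! 0) (\<lambda>k y. (k # y # tl xs) ! 1 - 1) (hd xs))"
    by (intro computable_primrec computable_pred computable_proj) simp_all
  moreover have "rec_nat a (\<lambda>k y. y - 1) b = a - b" for a b :: nat by (induction b) auto
  ultimately have "computable 2 (\<lambda>xs. xs ! 1 - xs ! 0)"
    by (subst computable_cong[where G = "\<lambda>xs. rec_nat ((tl xs) ! 0) (\<lambda>k y. (k # y # tl xs) ! 1 - 1) (hd xs)"])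
      (auto simp: numeral_2_eq_2 length_Suc_conv)
  from computable_comp2[OF this computable_proj computable_proj, of 1 2 0] show ?thesis by simp
qed

lemma computable_mul: "computable 2 (\<lambda>xs. xs ! 0 * xs ! 1)"
proof -
  have "computable (Suc 1) (\<lambda>xs. rec_nat ((\<lambda>xs. 0) (tl xs))
      (\<lambda>k y. (k # y # tl xs) ! 1 + (k # y # tl xs) ! 2) (hd xs))"
    by (intro computable_primrec computable_comp2[OF computable_add] computable_proj computable_const) simp_all
  moreover have "rec_nat 0 (\<lambda>k y. y + a) b = b * a" for a b :: nat by (induction b) auto
  ultimately show ?thesis
    by (subst computable_cong[where G = "\<lambda>xs. rec_nat 0
      (\<lambda>k y. (k # y # tl xs) ! 1 + (k # y # tl xs) ! 2) (hd xs)"])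
      (auto simp: numeral_2_eq_2 length_Suc_conv)
qed

text \<open>
  A bounded sum is the fold of addition along an initial segment of the numbers, a bounded product that
  of multiplication; both arise from one primitive recursion on the upper bound.
\<close>

lemma computable_fold:
  assumes op: "computable 2 (\<lambda>xs. op (xs ! 0) (xs ! 1))"
    and b: "computable n b" and t: "computable (Suc n) t"
  shows "computable n (\<lambda>xs. rec_nat c (\<lambda>k y. op y (t (k # xs))) (b xs))"
proof -
  let ?drop = "\<lambda>zs. t (zs ! 0 # tl (tl zs))"
  have "computable (Suc (Suc n)) (\<lambda>zs. t (map (\<lambda>g. g zs) ((\<lambda>zs. zs ! 0) # map (\<lambda>i zs. zs ! (2 + i)) [0..<n])))"
    by (rule computable_comp) (auto simp: t list_all_iff intro!: computable_proj)
  moreover have "map (\<lambda>g. g zs) ((\<lambda>zs. zs ! 0) # map (\<lambda>i zs. zs ! (2 + i)) [0..<n]) = zs ! 0 # tl (tl zs)"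
    if "length zs = Suc (Suc n)" for zs :: "nat list"
    using that by (auto simp: nth_tl intro!: nth_equalityI)
  ultimately have d: "computable (Suc (Suc n)) ?drop"
    by (subst computable_cong[where G = "\<lambda>zs. t (map (\<lambda>g. g zs) ((\<lambda>zs. zs ! 0) # map (\<lambda>i zs. zs ! (2 + i)) [0..<n]))"]) simp_all
  have "computable (Suc n) (\<lambda>xs. rec_nat ((\<lambda>xs. c) (tl xs))
      (\<lambda>k y. op ((k # y # tl xs) ! 1) (?drop (k # y # tl xs))) (hd xs))"
    by (intro computable_primrec computable_const computable_comp2[OF op] computable_proj d) simp
  from computable_comp[of "b # map (\<lambda>i xs. xs ! i) [0..<n]", simplified, OF this, of n]
  have "computable n (\<lambda>xs. rec_nat c (\<lambda>k y. op y (t (k # map ((!) xs) [0..<n]))) (b xs))"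
    using b by (simp add: list_all_iff computable_proj comp_def)
  moreover have "map ((!) xs) [0..<n] = xs" if "length xs = n" for xs :: "nat list"
    using that by (metis map_nth)
  ultimately show ?thesis
    by (subst computable_cong[where G = "\<lambda>xs. rec_nat c (\<lambda>k y. op y (t (k # map ((!) xs) [0..<n]))) (b xs)"]) simp_all
qed

lemma ev_fun:
  "ev (Var i) = (\<lambda>xs. xs ! i)"
  "ev (Num c) = (\<lambda>xs. c)"
  "ev (Add s t) = (\<lambda>xs. ev s xs + ev t xs)"
  "ev (Sub s t) = (\<lambda>xs. ev s xs - ev t xs)"
  "ev (Mul s t) = (\<lambda>xs. ev s xs * ev t xs)"
  by (simp_all add: fun_eq_iff)

theorem computable_ev: "wf_etm n t \<Longrightarrow> computable n (ev t)"
proof (induction t arbitrary: n)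
  case (Sum b t)
  have "rec_nat 0 (\<lambda>k y. y + f k) j = (\<Sum>k<j. f k)" for f :: "nat \<Rightarrow> nat" and j
    by (induction j) auto
  with computable_fold[OF computable_add, of n "ev b" "ev t" 0] Sum show ?case
    by (simp add: fun_eq_iff)
next
  case (Prod b t)
  have "rec_nat 1 (\<lambda>k y. y * f k) j = (\<Prod>k<j. f k)" for f :: "nat \<Rightarrow> nat" and j
    by (induction j) auto
  with computable_fold[OF computable_mul, of n "ev b" "ev t" 1] Prod show ?case
    by (simp add: fun_eq_iff)
next
  case (Call t ts)
  then have "computable n (\<lambda>xs. ev t (map (\<lambda>g. g xs) (map ev ts)))"
    by (intro computable_comp) (auto simp: list_all_iff)
  then show ?case by (simp add: comp_def)
qed (auto simp: ev_fun computable_proj computable_const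
    intro!: computable_comp2[OF computable_add] computable_comp2[OF computable_sub]
      computable_comp2[OF computable_mul])

subsection \<open>Arithmetic and logic\<close>

definition holds :: "etm \<Rightarrow> nat list \<Rightarrow> bool" where "holds t xs \<longleftrightarrow> ev t xs \<noteq> 0"

text \<open>
  Every nonzero value counts as true.  \<open>DivT\<close> counts the positive multiples of the divisor up to the
  dividend and relies on \<open>LeT\<close> taking no other values than \<open>0\<close> and \<open>1\<close>.
\<close>

definition "NotT t = Sub (Num 1) t"
definition "AndT s t = Mul s t"
definition "LeT s t = Sub (Num 1) (Sub s t)"
definition "EqT s t = AndT (LeT s t) (LeT t s)"
definition "PowT s t = Call (Prod (Var 1) (Var 1)) [s, t]"
definition "DivT s t = Call (Sum (Var 0) (LeT (Mul (Add (Var 0) (Num 1)) (Var 2)) (Var 1))) [s, t]"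
definition "ModT s t = Call (Sub (Var 0) (Mul (DivT (Var 0) (Var 1)) (Var 1))) [s, t]"
definition "DigT m k i = ModT (DivT k (PowT m i)) m"
definition "ImpT s t = NotT (AndT s (NotT t))"

lemma holds_simps [simp]:
  "holds (NotT t) xs \<longleftrightarrow> \<not> holds t xs"
  "holds (AndT s t) xs \<longleftrightarrow> holds s xs \<and> holds t xs"
  "holds (ImpT s t) xs \<longleftrightarrow> (holds s xs \<longrightarrow> holds t xs)"
  "holds (LeT s t) xs \<longleftrightarrow> ev s xs \<le> ev t xs"
  "holds (EqT s t) xs \<longleftrightarrow> ev s xs = ev t xs"
  "holds (Sum b t) xs \<longleftrightarrow> (\<exists>k<ev b xs. holds t (k # xs))"
  "holds (Prod b t) xs \<longleftrightarrow> (\<forall>k<ev b xs. holds t (k # xs))"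
  "holds (Call t ts) xs \<longleftrightarrow> holds t (map (\<lambda>s. ev s xs) ts)"
  by (auto simp: holds_def NotT_def AndT_def ImpT_def LeT_def EqT_def)

lemma ev_NotT: "ev (NotT t) xs = (if holds t xs then 0 else 1)"
  by (simp add: NotT_def holds_def)

lemma ev_PowT [simp]: "ev (PowT s t) xs = ev s xs ^ ev t xs"
  by (simp add: PowT_def)

lemma ev_DivT [simp]: "0 < ev t xs \<Longrightarrow> ev (DivT s t) xs = ev s xs div ev t xs"
proof -
  assume t: "0 < ev t xs"
  let ?s = "ev s xs" and ?t = "ev t xs"
  have "ev (DivT s t) xs = (\<Sum>k<?s. if Suc k \<le> ?s div ?t then 1 else 0)"
    by (auto simp: DivT_def LeT_def less_eq_div_iff_mult_less_eq t intro!: sum.cong)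
  also have "\<dots> = card {k. k < ?s \<and> Suc k \<le> ?s div ?t}"
    by (simp add: sum.If_cases Collect_conj_eq lessThan_def)
  also have "{k. k < ?s \<and> Suc k \<le> ?s div ?t} = {..<?s div ?t}"
    using div_le_dividend[of ?s ?t] by (auto simp del: div_le_dividend)
  finally show ?thesis by simp
qed

lemma ev_ModT [simp]: "0 < ev t xs \<Longrightarrow> ev (ModT s t) xs = ev s xs mod ev t xs"
  by (simp add: ModT_def minus_div_mult_eq_mod)

definition dig :: "nat \<Rightarrow> nat \<Rightarrow> nat \<Rightarrow> nat" where
  "dig m k i = (k div m ^ i) mod m"

lemma ev_DigT [simp]: "0 < ev m xs \<Longrightarrow> ev (DigT m k i) xs = dig (ev m xs) (ev k xs) (ev i xs)"
  by (simp add: DigT_def dig_def)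

lemma wf_macros [simp]:
  "wf_etm n (NotT t) = wf_etm n t"
  "wf_etm n (AndT s t) = (wf_etm n s \<and> wf_etm n t)"
  "wf_etm n (ImpT s t) = (wf_etm n s \<and> wf_etm n t)"
  "wf_etm n (LeT s t) = (wf_etm n s \<and> wf_etm n t)"
  "wf_etm n (EqT s t) = (wf_etm n s \<and> wf_etm n t)"
  "wf_etm n (PowT s t) = (wf_etm n s \<and> wf_etm n t)"
  "wf_etm n (DivT s t) = (wf_etm n s \<and> wf_etm n t)"
  "wf_etm n (ModT s t) = (wf_etm n s \<and> wf_etm n t)"
  "wf_etm n (DigT m k i) = (wf_etm n m \<and> wf_etm n k \<and> wf_etm n i)"
  by (auto simp: NotT_def AndT_def ImpT_def LeT_def EqT_def PowT_def DivT_def ModT_def DigT_def)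

subsection \<open>Digits\<close>

text \<open>
  The numbers below \<open>m ^ L\<close> are the words of length \<open>L\<close> over \<open>m\<close> letters.  Hence a quantifier over words
  is a quantifier over numbers with an elementary bound.
\<close>

lemma digits_exist:
  assumes "\<And>i. i < L \<Longrightarrow> f i < m"
  shows "\<exists>k<m ^ L. \<forall>i<L. dig m k i = f i"
  using assms
proof (induction L arbitrary: f)
  case 0
  then show ?case by auto
next
  case (Suc L)
  from Suc.IH[of "\<lambda>i. f (Suc i)"] Suc.prems obtain k where
    k: "k < m ^ L" "\<And>i. i < L \<Longrightarrow> dig m k i = f (Suc i)" by auto
  have f0: "f 0 < m" using Suc.prems by simp
  have "f 0 + m * k < m * (k + 1)" using f0 by simp
  also have "\<dots> \<le> m * m ^ L" using k(1) by (intro mult_left_mono) auto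
  finally have "f 0 + m * k < m ^ Suc L" by simp
  moreover have "dig m (f 0 + m * k) i = f i" if "i < Suc L" for i
  proof (cases i)
    case 0
    then show ?thesis using f0 by (simp add: dig_def)
  next
    case (Suc i')
    have "(f 0 + m * k) div m ^ i = ((f 0 + m * k) div m) div m ^ i'"
      by (simp add: Suc div_mult2_eq)
    also have "(f 0 + m * k) div m = k" using f0 by simp
    finally show ?thesis using k(2)[of i'] Suc that by (simp add: dig_def)
  qed
  ultimately show ?case by blast
qed

lemma dig_div: "dig m (k div m ^ a) i = dig m k (a + i)"
  by (simp add: dig_def power_add div_mult2_eq)

lemma dig_mod:
  assumes "i < L"
  shows "dig m (k mod m ^ L) i = dig m k i"
proof (cases "m = 0")
  case True
  then show ?thesis using assms by (cases i) (simp_all add: dig_def power_0_left)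
next
  case False
  obtain d where d: "L = i + Suc d" using assms by (metis add_Suc_right less_natE)
  have "k mod m ^ L div m ^ i = (k div m ^ i) mod m ^ Suc d"
    unfolding d power_add using False by (simp add: mod_mult2_eq)
  then show ?thesis by (simp add: dig_def mod_mult_right_eq mod_mod_cancel)
qed

subsection \<open>Edges\<close>

definition "PairT a b = Add (DivT (Mul (Add a b) (Add (Add a b) (Num 1))) (Num 2)) a"

lemma ev_PairT [simp]: "ev (PairT a b) xs = prod_encode (ev a xs, ev b xs)"
  by (simp add: PairT_def prod_encode_def triangle_def)

lemma wf_PairT [simp]: "wf_etm n (PairT a b) = (wf_etm n a \<and> wf_etm n b)"
  by (auto simp: PairT_def)

lemma list_encode_drop_bounds:
  "i \<le> length l \<Longrightarrow> list_encode (drop i l) \<le> list_encode l"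
proof (induction l arbitrary: i)
  case (Cons a l)
  have "list_encode l \<le> prod_encode (a, list_encode l)" by (rule le_prod_encode_2)
  with Cons show ?case by (cases i) (auto intro: le_SucI order_trans)
qed simp

lemma length_le_list_encode: "length l \<le> list_encode l"
proof (induction l)
  case (Cons a l)
  have "list_encode l \<le> prod_encode (a, list_encode l)" by (rule le_prod_encode_2)
  with Cons show ?case by simp
qed simp

lemma mem_less_list_encode: "e \<in> set l \<Longrightarrow> e < list_encode l"
proof (induction l)
  case (Cons a l)
  have "list_encode l \<le> prod_encode (a, list_encode l)" "a \<le> prod_encode (a, list_encode l)"
    by (rule le_prod_encode_2 le_prod_encode_1)+
  with Cons show ?case by auto
qed simp

text \<open>
  The codes of the successive tails of a list are bounded by the code of the list, so one number
  in base \<open>Suc (list_encode l)\<close> records all of them.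
\<close>

lemma mem_via_tails:
  fixes l :: "nat list"
  defines "g \<equiv> list_encode l"
  shows "e \<in> set l \<longleftrightarrow> (\<exists>j<Suc g. \<exists>t<Suc g ^ Suc g. dig (Suc g) t 0 = g \<and>
    (\<forall>i<j. \<exists>x<Suc g. dig (Suc g) t i = Suc (prod_encode (x, dig (Suc g) t (Suc i)))) \<and>
    (\<exists>y<Suc g. dig (Suc g) t j = Suc (prod_encode (e, y))))" (is "_ \<longleftrightarrow> ?R")
proof
  assume "e \<in> set l"
  then obtain j where j: "j < length l" "l ! j = e" by (auto simp: in_set_conv_nth)
  have len: "length l \<le> g" unfolding g_def by (rule length_le_list_encode)
  have "\<exists>t<Suc g ^ Suc g. \<forall>i<Suc g. dig (Suc g) t i = list_encode (drop i l)"
  proof (rule digits_exist)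
    fix i
    show "list_encode (drop i l) < Suc g"
      using list_encode_drop_bounds[of i l] by (cases "i \<le> length l") (auto simp: g_def)
  qed
  then obtain t where t: "t < Suc g ^ Suc g" "\<And>i. i < Suc g \<Longrightarrow> dig (Suc g) t i = list_encode (drop i l)"
    by blast
  have step: "dig (Suc g) t i = Suc (prod_encode (l ! i, dig (Suc g) t (Suc i)))" if "i < length l" for i
    using that len t(2)[of i] t(2)[of "Suc i"] Cons_nth_drop_Suc[OF that, symmetric] by simp
  have small: "l ! i < Suc g" if "i < length l" for i
    using mem_less_list_encode[of "l ! i" l] that by (simp add: g_def)
  have "dig (Suc g) t (Suc j) < Suc g" by (simp add: dig_def)
  then have last: "\<exists>y<Suc g. dig (Suc g) t j = Suc (prod_encode (e, y))"
    using step[OF j(1)] j(2) by blast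
  have mid: "\<exists>x<Suc g. dig (Suc g) t i = Suc (prod_encode (x, dig (Suc g) t (Suc i)))" if "i < j" for i
    using step[of i] small[of i] that j(1) by (meson less_trans)
  have "dig (Suc g) t 0 = g" using t(2)[of 0] by (simp add: g_def)
  moreover have "j < Suc g" using j(1) len by simp
  ultimately show ?R using t(1) last mid by blast
next
  assume ?R
  then obtain j t where t: "dig (Suc g) t 0 = g"
    "\<And>i. i < j \<Longrightarrow> \<exists>x. dig (Suc g) t i = Suc (prod_encode (x, dig (Suc g) t (Suc i)))"
    "\<exists>y. dig (Suc g) t j = Suc (prod_encode (e, y))" by blast
  have inv: "i \<le> length l \<and> dig (Suc g) t i = list_encode (drop i l)" if "i \<le> j" for i
    using that
  proof (induction i)
    case 0
    then show ?case using t(1) by (simp add: g_def)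
  next
    case (Suc i)
    then obtain x where x: "list_encode (drop i l) = Suc (prod_encode (x, dig (Suc g) t (Suc i)))"
      using t(2)[of i] by auto
    then have "drop i l \<noteq> []" by auto
    then have i: "i < length l" by simp
    then have "list_encode (drop i l) = Suc (prod_encode (l ! i, list_encode (drop (Suc i) l)))"
      by (subst Cons_nth_drop_Suc[symmetric]) simp_all
    with x i show ?case by simp
  qed
  obtain y where y: "list_encode (drop j l) = Suc (prod_encode (e, y))" using t(3) inv[of j] by auto
  then have "drop j l \<noteq> []" by auto
  then have j: "j < length l" by simp
  then have "list_encode (drop j l) = Suc (prod_encode (l ! j, list_encode (drop (Suc j) l)))"
    by (subst Cons_nth_drop_Suc[symmetric]) simp_all
  with y j show "e \<in> set l" by auto
qed

definition "MemT g e = Call (Sum (Add (Var 0) (Num 1)) (Sum (PowT (Add (Var 1) (Num 1)) (Add (Var 1) (Num 1)))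
  (AndT (EqT (DigT (Add (Var 2) (Num 1)) (Var 0) (Num 0)) (Var 2))
  (AndT (Prod (Var 1) (Sum (Add (Var 3) (Num 1)) (EqT (DigT (Add (Var 4) (Num 1)) (Var 2) (Var 1))
     (Add (PairT (Var 0) (DigT (Add (Var 4) (Num 1)) (Var 2) (Add (Var 1) (Num 1)))) (Num 1)))))
   (Sum (Add (Var 2) (Num 1)) (EqT (DigT (Add (Var 3) (Num 1)) (Var 1) (Var 2))
     (Add (PairT (Var 4) (Var 0)) (Num 1))))))))
  [g, e]"

lemma holds_MemT: "holds (MemT g e) xs \<longleftrightarrow> ev e xs \<in> set (list_decode (ev g xs))"
  unfolding mem_via_tails list_decode_inverse by (simp add: MemT_def numeral_2_eq_2 eval_nat_numeral)

text \<open>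
  The edge set as a function of the code alone, so that the evaluation rule for \<open>EdgeT\<close> does not
  mention the graph.
\<close>

definition edges_of :: "nat \<Rightarrow> (nat \<times> nat \<times> nat) set" where
  "edges_of g = {e. edge_encode e \<in> set (list_decode g)}"

lemma edges_of_graph_encode [simp]: "edges_of (graph_encode G) = set G"
  using inj_image_mem_iff[OF inj_edge_encode, of _ "set G"]
  by (auto simp: edges_of_def graph_encode_def)

definition "EdgeT g p a q = MemT g (PairT p (PairT a q))"

lemma holds_EdgeT [simp]:
  "holds (EdgeT g p a q) xs \<longleftrightarrow> (ev p xs, ev a xs, ev q xs) \<in> edges_of (ev g xs)"
  by (simp add: EdgeT_def holds_MemT edges_of_def edge_encode_def)

lemma wf_EdgeT [simp]: "wf_etm n (EdgeT g p a q) = (wf_etm n g \<and> wf_etm n p \<and> wf_etm n a \<and> wf_etm n q)"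
  by (auto simp: EdgeT_def MemT_def)

lemma edge_less_graph_encode:
  assumes "(p, a, q) \<in> set G"
  shows "p < graph_encode G" "a < graph_encode G" "q < graph_encode G"
proof -
  have "edge_encode (p, a, q) < graph_encode G"
    unfolding graph_encode_def using assms by (intro mem_less_list_encode) auto
  moreover have "p \<le> edge_encode (p, a, q)" unfolding edge_encode_def by (simp add: le_prod_encode_1)
  moreover have "a \<le> edge_encode (p, a, q)" "q \<le> edge_encode (p, a, q)"
    unfolding edge_encode_def
    using le_prod_encode_1[of a q] le_prod_encode_2[of q a] le_prod_encode_2[of "prod_encode (a, q)" p]
    by simp_all
  ultimately show "p < graph_encode G" "a < graph_encode G" "q < graph_encode G" by simp_all
qed

section \<open>Paths and transition types\<close>

fun walk :: "'a labelled_graph \<Rightarrow> nat \<Rightarrow> 'a list \<Rightarrow> nat \<Rightarrow> bool" where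
  "walk G p [] q \<longleftrightarrow> p = q"
| "walk G p (a # w) q \<longleftrightarrow> (\<exists>r. (p, a, r) \<in> set G \<and> walk G r w q)"

definition word :: "(int \<Rightarrow> 'a) \<Rightarrow> int \<Rightarrow> nat \<Rightarrow> 'a list" where
  "word x i d = map (\<lambda>j. x (i + int j)) [0..<d]"

definition vertices_below :: "'a labelled_graph \<Rightarrow> nat \<Rightarrow> bool" where
  "vertices_below G n \<longleftrightarrow> (\<forall>(p, a, q)\<in>set G. p < n \<and> q < n)"

definition labels_below :: "nat labelled_graph \<Rightarrow> nat \<Rightarrow> bool" where
  "labels_below G m \<longleftrightarrow> (\<forall>(p, a, q)\<in>set G. a < m)"

text \<open>
  Only vertices below \<open>n\<close> are related, also by the empty word, so that the number of types is at most
  \<open>2 ^ (n * n)\<close>.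
\<close>

definition wtype :: "'a labelled_graph \<Rightarrow> nat \<Rightarrow> 'a list \<Rightarrow> (nat \<times> nat) set" where
  "wtype G n w = {(p, q). p < n \<and> q < n \<and> walk G p w q}"

lemma length_word [simp]: "length (word x i d) = d"
  by (simp add: word_def)

lemma nth_word [simp]: "j < d \<Longrightarrow> word x i d ! j = x (i + int j)"
  by (simp add: word_def)

lemma word_add: "word x i (d + e) = word x i d @ word x (i + int d) e"
  by (rule nth_equalityI) (auto simp: nth_append algebra_simps of_nat_diff)

lemma word_cong: "(\<And>j. j < d \<Longrightarrow> x (i + int j) = y (k + int j)) \<Longrightarrow> word x i d = word y k d"
  by (simp add: word_def)

lemma walk_append: "walk G p (u @ v) q \<longleftrightarrow> (\<exists>r. walk G p u r \<and> walk G r v q)"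
  by (induction u arbitrary: p) auto

lemma walk_vertices:
  assumes "vertices_below G n" "walk G p w q" "w \<noteq> []"
  shows "p < n" "q < n"
proof -
  show "p < n" using assms by (cases w) (auto simp: vertices_below_def)
  show "q < n" using assms(2,3)
  proof (induction w arbitrary: p)
    case (Cons a w)
    then show ?case using assms(1) by (cases w) (auto simp: vertices_below_def)
  qed simp
qed

lemma walk_nth:
  "walk G p w q \<longleftrightarrow> (\<exists>v. v 0 = p \<and> v (length w) = q \<and> (\<forall>j<length w. (v j, w ! j, v (Suc j)) \<in> set G))"
proof (induction w arbitrary: p)
  case Nil
  then show ?case by auto
next
  case (Cons a w)
  show ?case
  proof
    assume "walk G p (a # w) q"
    then obtain r v where r: "(p, a, r) \<in> set G" "v 0 = r" "v (length w) = q"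
      "\<forall>j<length w. (v j, w ! j, v (Suc j)) \<in> set G" using Cons by auto
    then show "\<exists>v. v 0 = p \<and> v (length (a # w)) = q \<and>
        (\<forall>j<length (a # w). (v j, (a # w) ! j, v (Suc j)) \<in> set G)"
      by (intro exI[of _ "case_nat p v"]) (auto simp: less_Suc_eq_0_disj split: nat.splits)
  next
    assume "\<exists>v. v 0 = p \<and> v (length (a # w)) = q \<and>
        (\<forall>j<length (a # w). (v j, (a # w) ! j, v (Suc j)) \<in> set G)"
    then obtain v where v: "v 0 = p" "v (Suc (length w)) = q"
      "\<And>j. j < Suc (length w) \<Longrightarrow> (v j, (a # w) ! j, v (Suc j)) \<in> set G" by auto
    have "walk G (v 1) w q" unfolding Cons
      using v(2) v(3)[of "Suc _"] by (intro exI[of _ "\<lambda>j. v (Suc j)"]) auto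
    then show "walk G p (a # w) q" using v(1) v(3)[of 0] by auto
  qed
qed

lemma walk_word:
  "walk G p (word x i d) q \<longleftrightarrow>
    (\<exists>v. v 0 = p \<and> v d = q \<and> (\<forall>j<d. (v j, x (i + int j), v (Suc j)) \<in> set G))"
  by (simp add: walk_nth cong: conj_cong)

lemma label_sequences_walk:
  assumes "\<And>i. (v i, x i, v (i + 1)) \<in> set G"
  shows "walk G (v i) (word x i d) (v (i + int d))"
  unfolding walk_word
proof (intro exI[of _ "\<lambda>j. v (i + int j)"] conjI allI impI)
  show "(v (i + int j), x (i + int j), v (i + int (Suc j))) \<in> set G" for j
    using assms[of "i + int j"] by (simp add: algebra_simps)
qed simp_all

lemma wtype_append:
  assumes "vertices_below G n"
  shows "wtype G n (u @ v) = wtype G n u O wtype G n v"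
proof (cases "u = [] \<or> v = []")
  case True
  then show ?thesis by (auto simp: wtype_def)
next
  case False
  then show ?thesis using walk_vertices[OF assms]
    by (fastforce simp: wtype_def walk_append)
qed

lemma wtype_bound: "wtype G n w \<in> Pow ({..<n} \<times> {..<n})"
  by (auto simp: wtype_def)

lemma card_wtypes: "card (Pow ({..<n} \<times> {..<n :: nat})) = 2 ^ (n * n)"
  by (simp add: card_Pow card_cartesian_product)

text \<open>
  The purpose of types: replacing a factor by one of equal type does not disturb a path.
\<close>

lemma walk_wtype_cong:
  assumes "vertices_below G n" "wtype G n u = wtype G n w" "u \<noteq> []" "w \<noteq> []" "walk G p u q"
  shows "walk G p w q"
  using assms walk_vertices[OF assms(1,5,3)] by (auto simp: wtype_def)

subsection \<open>Pumping\<close>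

text \<open>
  By the pigeonhole principle the orbit enters a cycle within \<open>Q\<close> steps, and the length of that cycle
  divides \<open>fact Q\<close>.  The preperiod and the period are thus bounded without knowledge of \<open>g\<close>.
\<close>

lemma iterate_eventually_periodic:
  assumes step: "\<And>i. f (Suc i) = g (f i)" and ran: "\<And>i. f i \<in> S" and S: "finite S" "card S \<le> Q"
    and L: "Q \<le> L" and e: "fact Q dvd e"
  shows "f (L + e) = f L"
proof -
  have "\<not> inj_on f {..Q}"
  proof
    assume "inj_on f {..Q}"
    then have "card {..Q} \<le> card S" using S(1) ran by (intro card_inj_on_le[of f]) auto
    then show False using S(2) by simp
  qed
  then obtain a b where ab: "a < b" "b \<le> Q" "f a = f b"
    unfolding inj_on_def by (metis atMost_iff linorder_neqE_nat)
  \<comment> \<open>The iteration is deterministic, so one repetition propagates.\<close>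
  have shift: "f (b + i) = f (a + i)" for i
    by (induction i) (simp_all add: ab step)
  have period: "f (i + (b - a)) = f i" if "a \<le> i" for i
    using shift[of "i - a"] that ab(1) by (simp add: algebra_simps)
  have many: "f (i + (b - a) * j) = f i" if "a \<le> i" for i j
  proof (induction j)
    case (Suc j)
    then show ?case using period[of "i + (b - a) * j"] that by (simp add: add.assoc add.commute[of "b - a"])
  qed simp
  have "(b - a) dvd e" using ab e by (intro dvd_trans[OF _ e] dvd_fact) auto
  then obtain j where "e = (b - a) * j" by auto
  then show ?thesis using many[of L j] ab L by simp
qed

text \<open>
  Two prefixes of a long word have the same type, so the factor between them can be repeated.
  Repeating it \<open>E * J\<close> more times makes the added length a multiple of \<open>E\<close>.
\<close>

lemma pump_word:
  assumes G: "vertices_below G n" and w: "2 ^ (n * n) \<le> length w" and E: "0 < E"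
  shows "\<exists>w'. wtype G n w' = wtype G n w \<and> J \<le> length w' \<and> length w \<le> length w' \<and>
    E dvd length w' - length w"
proof -
  let ?S = "Pow ({..<n} \<times> {..<n})"
  have "\<not> inj_on (\<lambda>i. wtype G n (take i w)) {..length w}"
  proof
    assume "inj_on (\<lambda>i. wtype G n (take i w)) {..length w}"
    then have "card {..length w} \<le> card ?S"
      using wtype_bound[of G n] by (intro card_inj_on_le) auto
    then show False using w unfolding card_wtypes by simp
  qed
  then obtain a b where ab: "a < b" "b \<le> length w" "wtype G n (take a w) = wtype G n (take b w)"
    unfolding inj_on_def by (metis atMost_iff linorder_neqE_nat)
  define v where "v = drop a (take b w)"
  have tb: "take b w = take a w @ v"
    unfolding v_def using ab(1) by (metis append_take_drop_id less_imp_le min.absorb1 take_take)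
  have rep: "wtype G n (take a w @ concat (replicate i v)) = wtype G n (take a w)" for i
  proof (induction i)
    case (Suc i)
    have "concat (replicate (Suc i) v) = concat (replicate i v) @ v"
      by (metis append_Nil2 concat.simps concat_append replicate_Suc replicate_append_same)
    then have "wtype G n (take a w @ concat (replicate (Suc i) v)) =
      wtype G n (take a w @ concat (replicate i v)) O wtype G n v"
      using wtype_append[OF G] by (metis append.assoc)
    also have "\<dots> = wtype G n (take a w @ v)" by (simp only: Suc wtype_append[OF G, of "take a w" v])
    also have "\<dots> = wtype G n (take b w)" by (simp only: tb)
    finally show ?case using ab(3) by simp
  qed simp
  define w' where "w' = (take a w @ concat (replicate (1 + E * J) v)) @ drop b w"
  have v: "1 \<le> length v" using ab by (simp add: v_def)
  have len: "length w' = length w + length v * (E * J)"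
  proof -
    have "length v = b - a" using ab by (simp add: v_def)
    then have "length (take a w) + length v + length (drop b w) = length w" using ab by simp
    then show ?thesis by (simp add: w'_def length_concat sum_list_replicate algebra_simps)
  qed
  have "J \<le> length v * (E * J)" using v E by (cases "length v"; cases E) auto
  moreover have "wtype G n w' = wtype G n w"
  proof -
    have "wtype G n w' = wtype G n (take b w) O wtype G n (drop b w)"
      unfolding w'_def wtype_append[OF G, of _ "drop b w"] rep ab(3) ..
    also have "\<dots> = wtype G n w" unfolding wtype_append[OF G, symmetric] by simp
    finally show ?thesis .
  qed
  ultimately show ?thesis using len
    by (intro exI[of _ w'] conjI) (linarith, linarith, simp only: add_diff_cancel_left', simp)
qed

definition periodic :: "nat \<Rightarrow> (int \<Rightarrow> 'a) \<Rightarrow> bool" where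
  "periodic d z \<longleftrightarrow> (\<forall>i. z (i + int d) = z i)"

lemma periodic_mult: "periodic d z \<Longrightarrow> d dvd e \<Longrightarrow> periodic e z"
proof -
  assume z: "periodic d z" and "d dvd e"
  then obtain k where e: "e = d * k" by auto
  have "z (i + int (d * k)) = z i" for i
  proof (induction k)
    case (Suc k)
    have "z (i + int (d * Suc k)) = z (i + int (d * k) + int d)" by (simp add: algebra_simps)
    then show ?case using z Suc unfolding periodic_def by simp
  qed simp
  then show ?thesis by (simp add: periodic_def e)
qed

lemma word_periodic: "periodic d z \<Longrightarrow> word z (i + int d) e = word z i e"
  by (rule word_cong) (metis add.assoc add.commute periodic_def)

text \<open>
  In contrast to \<open>pump_word\<close> the longer word is again read off the periodic sequence: the types of the
  powers of one period form an orbit of a map on a finite set.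
\<close>

lemma wtype_periodic:
  assumes G: "vertices_below G n" and z: "periodic d z" and l: "d * 2 ^ (n * n) \<le> l"
    and e: "d * fact (2 ^ (n * n)) dvd e"
  shows "wtype G n (word z i (l + e)) = wtype G n (word z i l)"
proof -
  define Q :: nat where "Q = 2 ^ (n * n)"
  obtain j where e: "e = d * (fact Q * j)" using e by (auto simp: Q_def dvd_def mult.assoc)
  define r where "r = l - d * Q"
  have l: "l = d * Q + r" using l by (simp add: r_def Q_def)
  define f where "f k = wtype G n (word z i (d * k))" for k
  have f: "f (Q + fact Q * j) = f Q"
  proof (rule iterate_eventually_periodic[where g = "\<lambda>\<theta>. \<theta> O wtype G n (word z i d)"
      and S = "Pow ({..<n} \<times> {..<n})" and Q = Q])
    fix k
    have "word z i (d * Suc k) = word z i (d * k) @ word z (i + int (d * k)) d"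
      by (subst word_add[symmetric]) (simp add: add.commute)
    also have "word z (i + int (d * k)) d = word z i d"
      by (rule word_periodic) (rule periodic_mult[OF z], simp)
    finally show "f (Suc k) = f k O wtype G n (word z i d)" by (simp add: f_def wtype_append[OF G])
    show "f k \<in> Pow ({..<n} \<times> {..<n})" unfolding f_def by (rule wtype_bound)
  qed (simp_all add: card_wtypes Q_def[symmetric] del: card_Pow)
  have "l + e = d * (Q + fact Q * j) + r" by (simp add: l e algebra_simps)
  moreover have "i + int (d * (Q + fact Q * j)) = i + int (d * Q) + int e"
    by (simp add: e algebra_simps)
  ultimately have "word z i (l + e) =
      word z i (d * (Q + fact Q * j)) @ word z (i + int (d * Q) + int e) r"
    by (simp only: word_add)
  also have "word z (i + int (d * Q) + int e) r = word z (i + int (d * Q)) r"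
    by (rule word_periodic) (rule periodic_mult[OF z], simp add: e)
  finally show ?thesis
    using f by (simp add: l word_add wtype_append[OF G] f_def)
qed

text \<open>
  The set of types of words of length \<open>L + 1\<close> is a function of the set of types of words of length
  \<open>L\<close>.  These sets therefore form an eventually periodic sequence, and a type realized at length \<open>L + e\<close>
  is realized at length \<open>L\<close>.
\<close>

lemma shrink_word:
  assumes G: "vertices_below G n" and L: "2 ^ (2 ^ (n * n)) \<le> L"
    and len: "length u = L + e" and e: "fact (2 ^ (2 ^ (n * n))) dvd e"
  shows "\<exists>w. length w = L \<and> wtype G n w = wtype G n u"
proof -
  define f where "f L = wtype G n ` {w. length w = L}" for L
  define g :: "(nat \<times> nat) set set \<Rightarrow> (nat \<times> nat) set set"
    where "g A = (\<lambda>(\<theta>, a). \<theta> O wtype G n [a]) ` (A \<times> UNIV)" for A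
  have "f (L + e) = f L"
  proof (rule iterate_eventually_periodic[where g = g and S = "Pow (Pow ({..<n} \<times> {..<n}))" and Q = "2 ^ 2 ^ (n * n)"])
    fix k
    have split: "\<exists>u a. w = u @ [a] \<and> length u = k" if "length w = Suc k" for w :: "'a list"
      using that by (cases w rule: rev_cases) auto
    show "f (Suc k) = g (f k)"
    proof (intro equalityI subsetI)
      fix \<theta> assume "\<theta> \<in> f (Suc k)"
      then obtain w where "length w = Suc k" "\<theta> = wtype G n w" by (auto simp: f_def)
      moreover from split[OF this(1)] obtain u a where "w = u @ [a]" "length u = k" by blast
      ultimately have "\<theta> = wtype G n u O wtype G n [a]" "wtype G n u \<in> f k"
        by (simp_all add: f_def wtype_append[OF G])
      then show "\<theta> \<in> g (f k)" unfolding g_def by (intro image_eqI[of _ _ "(wtype G n u, a)"]) auto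
    next
      fix \<theta> assume "\<theta> \<in> g (f k)"
      then obtain u a where "length u = k" "\<theta> = wtype G n u O wtype G n [a]"
        by (auto simp: f_def g_def)
      then have "\<theta> = wtype G n (u @ [a])" "length (u @ [a]) = Suc k"
        by (simp_all only: wtype_append[OF G] length_append_singleton)
      then show "\<theta> \<in> f (Suc k)" unfolding f_def by (intro image_eqI[of _ _ "u @ [a]"]) auto
    qed
    show "f k \<in> Pow (Pow ({..<n} \<times> {..<n}))"
      unfolding f_def using wtype_bound[of G n] by blast
  next
    show "card (Pow (Pow ({..<n} \<times> {..<n}))) \<le> 2 ^ 2 ^ (n * n)"
      by (simp add: card_Pow card_cartesian_product)
  qed (use L e in simp_all)
  moreover have "wtype G n u \<in> f (L + e)" by (simp add: f_def len)
  ultimately show ?thesis unfolding f_def by auto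
qed

subsection \<open>Gluing bi-infinite sequences from pieces\<close>

text \<open>
  A bi-infinite strictly increasing sequence of integers, which splits the integers into the intervals
  from \<open>s k\<close> up to \<open>s (k + 1)\<close>.
\<close>

definition cuts :: "(int \<Rightarrow> int) \<Rightarrow> bool" where
  "cuts s \<longleftrightarrow> (\<forall>k. s k < s (k + 1))"

lemma cuts_mono: "cuts s \<Longrightarrow> k \<le> k' \<Longrightarrow> s k + (k' - k) \<le> s k'"
proof -
  assume s: "cuts s" and k: "k \<le> k'"
  from k show ?thesis
  proof (induction k' rule: int_ge_induct)
    case (step i)
    have "s i < s (i + 1)" using s by (simp add: cuts_def)
    with step show ?case by simp
  qed simp
qed

lemma cuts_unique:
  assumes "cuts s" "s k \<le> i" "i < s (k + 1)" "s k' \<le> i" "i < s (k' + 1)"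
  shows "k = k'"
proof (rule ccontr)
  assume "k \<noteq> k'"
  then consider "k + 1 \<le> k'" | "k' + 1 \<le> k" by linarith
  then show False
    using cuts_mono[OF assms(1), of "k + 1" k'] cuts_mono[OF assms(1), of "k' + 1" k] assms by cases auto
qed

lemma cuts_exists:
  assumes "cuts s"
  shows "\<exists>k. s k \<le> i \<and> i < s (k + 1)"
proof -
  obtain k0 where k0: "k0 \<le> 0" "s 0 + k0 \<le> i"
    by (rule that[of "min 0 (i - s 0)"]) auto
  obtain k1 where k1: "0 \<le> k1" "i < s 0 + k1"
    by (rule that[of "max 0 (i - s 0 + 1)"]) auto
  have "s k0 \<le> i" using cuts_mono[OF assms k0(1)] k0(2) by linarith
  moreover have "i < s k1" using cuts_mono[OF assms k1(1)] k1(2) by linarith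
  moreover have "\<exists>k. s k \<le> i \<and> i < s (k + 1)" if "s k0 \<le> i" "i < s (k0 + int n)" for n
    using that
  proof (induction n)
    case (Suc n)
    show ?case
    proof (cases "i < s (k0 + int n)")
      case False
      then show ?thesis using Suc.prems(2)
        by (intro exI[of _ "k0 + int n"]) (simp add: algebra_simps)
    qed (use Suc in blast)
  qed simp
  from this[of "nat (k1 - k0)"] have "s k0 \<le> i \<Longrightarrow> i < s k1 \<Longrightarrow> \<exists>k. s k \<le> i \<and> i < s (k + 1)"
    using k0(1) k1(1) by simp
  ultimately show ?thesis by blast
qed

definition piece :: "(int \<Rightarrow> int) \<Rightarrow> int \<Rightarrow> int" where
  "piece s i = (THE k. s k \<le> i \<and> i < s (k + 1))"

lemma piece_eq: "cuts s \<Longrightarrow> s k \<le> i \<Longrightarrow> i < s (k + 1) \<Longrightarrow> piece s i = k"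
  unfolding piece_def by (rule the_equality) (auto intro: cuts_unique)

lemma cuts_from_gaps:
  fixes d :: "int \<Rightarrow> int"
  shows "\<exists>s. s 0 = 0 \<and> (\<forall>k. s (k + 1) = s k + d k)"
proof -
  let ?s = "\<lambda>k :: int. (\<Sum>i\<in>{0..<k}. d i) - (\<Sum>i\<in>{k..<0}. d i)"
  have "?s (k + 1) = ?s k + d k" for k
  proof (cases "0 \<le> k")
    case True
    then have "{0..<k + 1} = insert k {0..<k}" by auto
    then show ?thesis using True by simp
  next
    case False
    then have "{k..<0} = insert k {k + 1..<0}" by auto
    then show ?thesis using False by simp
  qed
  moreover have "?s 0 = 0" by simp
  ultimately show ?thesis by (intro exI[of _ ?s]) blast
qed

text \<open>
  Paths over consecutive pieces that meet in common vertices form one bi-infinite path.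
\<close>

lemma glue_walk:
  assumes s: "cuts s" and p: "\<And>k. walk G (u k) (word y (s k) (nat (s (k + 1) - s k))) (u (k + 1))"
  shows "y \<in> label_sequences G"
proof -
  have "\<exists>v. v 0 = u k \<and> v (nat (s (k + 1) - s k)) = u (k + 1) \<and>
      (\<forall>j<nat (s (k + 1) - s k). (v j, y (s k + int j), v (Suc j)) \<in> set G)" for k
    using p[of k] unfolding walk_word .
  then obtain v where v: "\<And>k. v k 0 = u k" "\<And>k. v k (nat (s (k + 1) - s k)) = u (k + 1)"
    "\<And>k j. j < nat (s (k + 1) - s k) \<Longrightarrow> (v k j, y (s k + int j), v k (Suc j)) \<in> set G"
    by metis
  define V where "V i = v (piece s i) (nat (i - s (piece s i)))" for i
  have "(V i, y i, V (i + 1)) \<in> set G" for i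
  proof -
    obtain k where k: "s k \<le> i" "i < s (k + 1)" using cuts_exists[OF s] by blast
    then have Vi: "V i = v k (nat (i - s k))" by (simp add: V_def piece_eq[OF s])
    have "V (i + 1) = v k (nat (i + 1 - s k))"
    proof (cases "i + 1 < s (k + 1)")
      case True
      with k show ?thesis by (simp add: V_def piece_eq[OF s, of k])
    next
      case False
      with k have i: "i + 1 = s (k + 1)" by simp
      have "s (k + 1) < s (k + 1 + 1)" using s unfolding cuts_def by blast
      then have "piece s (i + 1) = k + 1" using i by (intro piece_eq[OF s]) auto
      then show ?thesis using v(1)[of "k + 1"] v(2)[of k] by (simp add: V_def i)
    qed
    moreover have "Suc (nat (i - s k)) = nat (i + 1 - s k)" using k by simp
    ultimately show ?thesis using v(3)[of "nat (i - s k)" k] k Vi by simp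
  qed
  then show ?thesis unfolding label_sequences_def by blast
qed

lemma glue_words:
  assumes s: "cuts s" and len: "\<And>k. s (k + 1) = s k + int (length (W k))"
  shows "\<exists>y. \<forall>k. word y (s k) (length (W k)) = W k"
proof (intro exI allI)
  fix k
  let ?y = "\<lambda>i. W (piece s i) ! nat (i - s (piece s i))"
  have "piece s (s k + int j) = k" if "j < length (W k)" for j
    using that len[of k] by (intro piece_eq[OF s]) auto
  then show "word ?y (s k) (length (W k)) = W k"
    by (intro nth_equalityI) auto
qed

subsection \<open>Compactness\<close>

text \<open>
  Koenig's lemma, as compactness of the space of vertex sequences: finitely many edge conditions
  involve only a finite interval, on which a finite path satisfies them.
\<close>

lemma label_sequence_if_finite_words:
  assumes "\<And>d. \<exists>p q. walk G p (word y (- int d) (2 * d)) q"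
  shows "y \<in> label_sequences G"
proof -
  define A where "A = insert 0 (fst ` set G \<union> (snd \<circ> snd) ` set G)"
  define C where "C i = {v :: int \<Rightarrow> nat. (v i, y i, v (i + 1)) \<in> set G}" for i
  have closed: "closed (C i)" for i
  proof -
    have coord: "closed {v :: int \<Rightarrow> nat. v j = p}" for j p
    proof -
      have "closed ((\<lambda>v :: int \<Rightarrow> nat. v j) -` {p})"
        by (rule closed_vimage) (auto simp: closed_def open_discrete continuous_on_product_coordinates)
      then show ?thesis by (simp add: vimage_def)
    qed
    have "C i = (\<Union>e\<in>set G. {v. (v i = fst e \<and> v (i + 1) = snd (snd e)) \<and> y i = fst (snd e)})"
      unfolding C_def by force
    then show ?thesis
      by (simp only:) (intro closed_UN ballI closed_Collect_conj closed_Collect_const coord finite_set)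
  qed
  have "compact {v :: int \<Rightarrow> nat. range v \<subseteq> A}"
    by (rule compact_full_shift) (simp add: A_def)
  then have "{v :: int \<Rightarrow> nat. range v \<subseteq> A} \<inter> (\<Inter>i\<in>UNIV. C i) \<noteq> {}"
  proof (rule compact_imp_fip_image)
    fix I :: "int set"
    assume I: "finite I"
    define d where "d = nat (Max (insert 0 (abs ` I))) + 1"
    have d: "\<bar>i\<bar> < int d" if "i \<in> I" for i
    proof -
      have "\<bar>i\<bar> \<le> Max (insert 0 (abs ` I))" using I that by (intro Max_ge) auto
      moreover have "0 \<le> Max (insert 0 (abs ` I))" using I by (intro Max_ge) auto
      ultimately show ?thesis by (simp add: d_def)
    qed
    obtain p q where "walk G p (word y (- int d) (2 * d)) q" using assms by blast
    then obtain v where v: "\<And>j. j < 2 * d \<Longrightarrow> (v j, y (- int d + int j), v (Suc j)) \<in> set G"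
      unfolding walk_word by blast
    define V where "V i = (if - int d \<le> i \<and> i \<le> int d then v (nat (i + int d)) else 0)" for i
    have edge: "(V i, y i, V (i + 1)) \<in> set G" if "- int d \<le> i" "i < int d" for i
    proof -
      have "Suc (nat (i + int d)) = nat (i + 1 + int d)" using that by simp
      then show ?thesis using v[of "nat (i + int d)"] that by (simp add: V_def)
    qed
    have A: "p \<in> A" "q \<in> A" if "(p, a, q) \<in> set G" for p a q
      using imageI[OF that, of fst] imageI[OF that, of "snd \<circ> snd"] by (simp_all add: A_def)
    have "V i \<in> A" for i
    proof -
      consider "- int d \<le> i" "i < int d" | "i = int d" | "\<not> (- int d \<le> i \<and> i \<le> int d)" by linarith
      then show ?thesis
      proof cases
        case 1
        show ?thesis by (rule A(1)[OF edge[OF 1]])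
      next
        case 2
        have "1 \<le> d" by (simp add: d_def)
        with 2 show ?thesis using A(2)[OF edge[of "int d - 1"]] by simp
      next
        case 3
        then show ?thesis unfolding V_def if_not_P[OF 3] by (simp add: A_def)
      qed
    qed
    moreover have "V \<in> C i" if "i \<in> I" for i
      using edge[of i] d[OF that] by (simp add: C_def)
    ultimately show "{v :: int \<Rightarrow> nat. range v \<subseteq> A} \<inter> (\<Inter>i\<in>I. C i) \<noteq> {}" by blast
  qed (use closed in auto)
  then obtain V where "\<And>i. V \<in> C i" by blast
  then show ?thesis unfolding C_def label_sequences_def mem_Collect_eq by blast
qed

section \<open>Markers\<close>

text \<open>
  The two positions may differ.  A function of a point and a position that respects \<open>agree r\<close> is thus
  at once local with radius \<open>r\<close> and equivariant under the shift.
\<close>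

definition agree :: "nat \<Rightarrow> (int \<Rightarrow> 'a) \<Rightarrow> int \<Rightarrow> (int \<Rightarrow> 'a) \<Rightarrow> int \<Rightarrow> bool" where
  "agree r x i y k \<longleftrightarrow> (\<forall>j. \<bar>j\<bar> \<le> int r \<longrightarrow> x (i + j) = y (k + j))"

lemma agreeD: "agree r x i y k \<Longrightarrow> \<bar>j\<bar> \<le> int r \<Longrightarrow> x (i + j) = y (k + j)"
  by (simp add: agree_def)

lemma agree_shift: "agree r x i y k \<Longrightarrow> \<bar>d\<bar> + int r' \<le> int r \<Longrightarrow> agree r' x (i + d) y (k + d)"
  unfolding agree_def by (simp add: add.assoc)

lemma agree_mono: "agree r x i y k \<Longrightarrow> r' \<le> r \<Longrightarrow> agree r' x i y k"
  unfolding agree_def by simp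

definition far :: "nat \<Rightarrow> int set \<Rightarrow> int \<Rightarrow> bool" where
  "far N S i \<longleftrightarrow> (\<forall>d. \<bar>d\<bar> < int N \<longrightarrow> i + d \<notin> S)"

lemma farD: "far N S i \<Longrightarrow> k \<in> S \<Longrightarrow> int N \<le> \<bar>k - i\<bar>"
  unfolding far_def by (metis add_diff_cancel_left' diff_add_cancel add.commute not_le)

lemma Least_cong: "(\<And>d. d \<le> b \<Longrightarrow> P d = Q d) \<Longrightarrow> \<exists>d\<le>b. P d \<Longrightarrow> (LEAST d :: nat. P d) = (LEAST d. Q d)"
proof -
  assume eq: "\<And>d. d \<le> b \<Longrightarrow> P d = Q d" and ex: "\<exists>d\<le>b. P d"
  then obtain d where d: "d \<le> b" "P d" by blast
  have le: "(LEAST d. P d) \<le> b" "(LEAST d. Q d) \<le> b"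
    using d eq Least_le[of P d] Least_le[of Q d] by auto
  have "P (LEAST d. P d)" "Q (LEAST d. Q d)" using d eq by (auto intro: LeastI)
  then show ?thesis using le eq by (intro antisym Least_le) auto
qed

text \<open>
  Krieger's marker construction.  Here \<open>N\<close> separates the markers and bounds the periods, \<open>l\<close> is the
  distance from all markers at which a position counts as free, and \<open>K\<close> is the radius of the windows in
  which periodicity is observed.  The bound \<open>N * N \<le> K\<close> makes overlapping windows with periods below
  \<open>N\<close> determine the same periodic point.
\<close>

locale markers =
  fixes N l K m r :: nat and color :: "nat list \<Rightarrow> nat"
  assumes N: "1 \<le> N" and l: "N \<le> l" and K: "2 * l \<le> K" "N * N \<le> K"
    and inj: "inj_on color {w. set w \<subseteq> {..<m} \<and> length w = 2 * K + 1}"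
    and colors: "\<And>w. set w \<subseteq> {..<m} \<Longrightarrow> length w = 2 * K + 1 \<Longrightarrow> color w < r"
begin

definition per_at :: "(int \<Rightarrow> nat) \<Rightarrow> int \<Rightarrow> nat \<Rightarrow> bool" where
  "per_at x i d \<longleftrightarrow> 1 \<le> d \<and> d < N \<and>
    (\<forall>j. - int K \<le> j \<and> j + int d \<le> int K \<longrightarrow> x (i + j) = x (i + (j + int d)))"

definition window :: "(int \<Rightarrow> nat) \<Rightarrow> int \<Rightarrow> nat list" where
  "window x i = word x (i - int K) (2 * K + 1)"

text \<open>
  A greedy choice through the finitely many window colours: in stage \<open>j\<close> the positions with colour \<open>j\<close>
  become markers unless their window has a short period or a marker of an earlier stage is close.
\<close>

fun marks :: "(int \<Rightarrow> nat) \<Rightarrow> nat \<Rightarrow> int set" where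
  "marks x 0 = {}"
| "marks x (Suc j) = marks x j \<union>
    {i. color (window x i) = j \<and> (\<nexists>d. per_at x i d) \<and> far N (marks x j) i}"

definition marker :: "(int \<Rightarrow> nat) \<Rightarrow> int \<Rightarrow> bool" where
  "marker x i \<longleftrightarrow> i \<in> marks x r"

definition free :: "(int \<Rightarrow> nat) \<Rightarrow> int \<Rightarrow> bool" where
  "free x i \<longleftrightarrow> far l (marks x r) i"

definition cut :: "(int \<Rightarrow> nat) \<Rightarrow> int \<Rightarrow> bool" where
  "cut x i \<longleftrightarrow> marker x i \<or> free x i"

subsection \<open>Locality\<close>

lemma per_at_local: "agree K x i y k \<Longrightarrow> per_at x i d = per_at y k d"
proof -
  assume a: "agree K x i y k"
  have "x (i + j) = y (k + j)" if "- int K \<le> j" "j \<le> int K" for j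
    by (rule agreeD[OF a]) (use that in linarith)
  then show ?thesis unfolding per_at_def by auto
qed

lemma window_local: "agree K x i y k \<Longrightarrow> window x i = window y k"
proof -
  assume a: "agree K x i y k"
  have "x (i + (int j - int K)) = y (k + (int j - int K))" if "j < 2 * K + 1" for j
    by (rule agreeD[OF a]) (use that in linarith)
  then show ?thesis unfolding window_def by (intro word_cong) (simp add: algebra_simps)
qed

lemma marks_local: "agree (K + N * j) x i y k \<Longrightarrow> i \<in> marks x j \<longleftrightarrow> k \<in> marks y j"
proof (induction j arbitrary: i k)
  case (Suc j)
  have aK: "agree K x i y k" using Suc.prems by (rule agree_mono) simp
  have "i \<in> marks x j \<longleftrightarrow> k \<in> marks y j"
    by (rule Suc.IH, rule agree_mono[OF Suc.prems]) simp
  moreover have "far N (marks x j) i \<longleftrightarrow> far N (marks y j) k"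
  proof -
    have "i + d \<in> marks x j \<longleftrightarrow> k + d \<in> marks y j" if "\<bar>d\<bar> < int N" for d
      by (rule Suc.IH, rule agree_shift[OF Suc.prems]) (use that in simp)
    then show ?thesis unfolding far_def by simp
  qed
  ultimately show ?case
    using window_local[OF aK] per_at_local[OF aK] by simp
qed simp

abbreviation "cut_radius \<equiv> K + N * r + l"

lemma marker_local: "agree cut_radius x i y k \<Longrightarrow> marker x i = marker y k"
  unfolding marker_def by (rule marks_local, erule agree_mono) simp

lemma free_local: "agree cut_radius x i y k \<Longrightarrow> free x i = free y k"
proof -
  assume a: "agree cut_radius x i y k"
  have "i + d \<in> marks x r \<longleftrightarrow> k + d \<in> marks y r" if "\<bar>d\<bar> < int l" for d
    by (rule marks_local, rule agree_shift[OF a]) (use that in simp)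
  then show ?thesis unfolding free_def far_def by simp
qed

lemma cut_local: "agree cut_radius x i y k \<Longrightarrow> cut x i = cut y k"
  unfolding cut_def using marker_local free_local by blast

subsection \<open>Separation and covering\<close>

text \<open>
  Two positions of the same stage have equal windows.  If they were close, the distance would be a
  period of the window.
\<close>

lemma marks_separated:
  assumes x: "range x \<subseteq> {..<m}"
  shows "i \<in> marks x j \<Longrightarrow> k \<in> marks x j \<Longrightarrow> i < k \<Longrightarrow> int N \<le> k - i"
proof (induction j)
  case (Suc j)
  consider "i \<in> marks x j" "k \<in> marks x j" | "i \<in> marks x j" "far N (marks x j) k"
    | "far N (marks x j) i" "k \<in> marks x j"
    | "color (window x i) = color (window x k)" "\<nexists>d. per_at x i d"
    using Suc.prems(1,2) by auto
  then show ?case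
  proof cases
    case 1
    then show ?thesis using Suc by blast
  next
    case 2
    then show ?thesis using farD[of N "marks x j" k i] Suc.prems(3) by simp
  next
    case 3
    then show ?thesis using farD[of N "marks x j" i k] Suc.prems(3) by simp
  next
    case 4
    show ?thesis
    proof (rule ccontr)
      assume close: "\<not> int N \<le> k - i"
      have "window x i = window x k"
        by (rule inj_onD[OF inj 4(1)]) (use x in \<open>auto simp: window_def word_def\<close>)
      then have eq: "x (i + j) = x (k + j)" if "- int K \<le> j" "j \<le> int K" for j
      proof -
        have "window x i ! nat (j + int K) = window x k ! nat (j + int K)"
          using \<open>window x i = window x k\<close> by simp
        moreover have "nat (j + int K) < 2 * K + 1" using that by linarith
        ultimately show ?thesis using that by (simp add: window_def)
      qed
      have "per_at x i (nat (k - i))"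
        unfolding per_at_def using close Suc.prems(3) eq
        by (auto simp: nat_less_iff algebra_simps)
      with 4(2) show False by blast
    qed
  qed
qed simp

lemma marks_mono: "j \<le> j' \<Longrightarrow> marks x j \<subseteq> marks x j'"
  by (induction j' rule: dec_induct) auto

text \<open>
  A position with aperiodic window becomes a marker in the stage of its colour unless a marker is
  already near; in either case it is not free.
\<close>

lemma free_periodic:
  assumes x: "range x \<subseteq> {..<m}" and free: "free x i"
  shows "\<exists>d. per_at x i d"
proof (rule ccontr)
  assume not: "\<nexists>d. per_at x i d"
  define j where "j = color (window x i)"
  have "j < r" unfolding j_def window_def by (rule colors) (use x in \<open>auto simp: word_def\<close>)
  then have sub: "marks x j \<subseteq> marks x r" "marks x (Suc j) \<subseteq> marks x r"
    by (intro marks_mono; simp)+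
  have far: "far N (marks x r) i" using free l unfolding free_def far_def by auto
  then have "far N (marks x j) i" using sub(1) unfolding far_def by blast
  then have "i \<in> marks x r" using sub(2) not j_def by auto
  then show False using farD[OF far] N by fastforce
qed

lemma markers_separated:
  "range x \<subseteq> {..<m} \<Longrightarrow> marker x i \<Longrightarrow> marker x k \<Longrightarrow> i < k \<Longrightarrow> int N \<le> k - i"
  unfolding marker_def by (rule marks_separated)

lemma free_marker_distance: "free x i \<Longrightarrow> marker x k \<Longrightarrow> int l \<le> \<bar>k - i\<bar>"
  unfolding free_def marker_def by (rule farD)

lemma not_free_marker: "\<not> free x i \<Longrightarrow> \<exists>k. marker x k \<and> \<bar>k - i\<bar> < int l"
  unfolding free_def far_def marker_def by (metis add_diff_cancel_left')

subsection \<open>Cuts\<close>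

text \<open>
  Every interval of length \<open>2 * l\<close> contains a cut, hence the distances to the neighbouring cuts and
  the offset from the last cut are local functions.
\<close>

definition nxt :: "(int \<Rightarrow> nat) \<Rightarrow> int \<Rightarrow> nat" where
  "nxt x i = (LEAST d. 1 \<le> d \<and> cut x (i + int d))"

definition prv :: "(int \<Rightarrow> nat) \<Rightarrow> int \<Rightarrow> nat" where
  "prv x i = (LEAST d. 1 \<le> d \<and> cut x (i - int d))"

definition offset :: "(int \<Rightarrow> nat) \<Rightarrow> int \<Rightarrow> nat" where
  "offset x i = (LEAST d. cut x (i - int d))"

lemma cut_near: "\<exists>k. cut x k \<and> \<bar>k - i\<bar> < int l"
proof (cases "free x i")
  case True
  then show ?thesis using l N by (intro exI[of _ i]) (simp add: cut_def)
next
  case False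
  then show ?thesis using not_free_marker unfolding cut_def by blast
qed

lemma next_cut_exists: "\<exists>d\<le>2 * l. 1 \<le> d \<and> cut x (i + int d)"
proof -
  obtain k where k: "cut x k" "\<bar>k - (i + int l)\<bar> < int l" using cut_near by blast
  have "i + int (nat (k - i)) = k" "nat (k - i) \<le> 2 * l" "1 \<le> nat (k - i)"
    using k(2) by linarith+
  then show ?thesis using k(1) by metis
qed

lemma prev_cut_exists: "\<exists>d\<le>2 * l. 1 \<le> d \<and> cut x (i - int d)"
proof -
  obtain k where k: "cut x k" "\<bar>k - (i - int l)\<bar> < int l" using cut_near by blast
  have "i - int (nat (i - k)) = k" "nat (i - k) \<le> 2 * l" "1 \<le> nat (i - k)"
    using k(2) by linarith+
  then show ?thesis using k(1) by metis
qed

lemma nxt: "1 \<le> nxt x i" "nxt x i \<le> 2 * l" "cut x (i + int (nxt x i))"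
  and nxt_least: "i < k \<Longrightarrow> k < i + int (nxt x i) \<Longrightarrow> \<not> cut x k"
proof -
  obtain d where d: "d \<le> 2 * l" "1 \<le> d \<and> cut x (i + int d)" using next_cut_exists by blast
  show "1 \<le> nxt x i" "cut x (i + int (nxt x i))"
    using LeastI[of "\<lambda>d. 1 \<le> d \<and> cut x (i + int d)", OF d(2)] by (simp_all add: nxt_def)
  show "nxt x i \<le> 2 * l"
    using Least_le[of "\<lambda>d. 1 \<le> d \<and> cut x (i + int d)", OF d(2)] d(1) by (simp add: nxt_def)
  assume "i < k" "k < i + int (nxt x i)"
  then show "\<not> cut x k"
    using not_less_Least[of "nat (k - i)" "\<lambda>d. 1 \<le> d \<and> cut x (i + int d)"]
    by (auto simp: nxt_def)
qed

lemma prv: "1 \<le> prv x i" "prv x i \<le> 2 * l" "cut x (i - int (prv x i))"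
  and prv_least: "k < i \<Longrightarrow> i - int (prv x i) < k \<Longrightarrow> \<not> cut x k"
proof -
  obtain d where d: "d \<le> 2 * l" "1 \<le> d \<and> cut x (i - int d)" using prev_cut_exists by blast
  show "1 \<le> prv x i" "cut x (i - int (prv x i))"
    using LeastI[of "\<lambda>d. 1 \<le> d \<and> cut x (i - int d)", OF d(2)] by (simp_all add: prv_def)
  show "prv x i \<le> 2 * l"
    using Least_le[of "\<lambda>d. 1 \<le> d \<and> cut x (i - int d)", OF d(2)] d(1) by (simp add: prv_def)
  assume "k < i" "i - int (prv x i) < k"
  then show "\<not> cut x k"
    using not_less_Least[of "nat (i - k)" "\<lambda>d. 1 \<le> d \<and> cut x (i - int d)"]
    by (auto simp: prv_def)
qed

lemma offset_le: "offset x i \<le> 2 * l"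
  using prev_cut_exists[of x i] Least_le[of "\<lambda>d. cut x (i - int d)"]
  unfolding offset_def by (meson order_trans)

lemma offset_eq:
  assumes "cut x t" "j < nxt x t"
  shows "offset x (t + int j) = j"
  unfolding offset_def
proof (rule Least_equality)
  fix d assume d: "cut x (t + int j - int d)"
  show "j \<le> d"
  proof (rule ccontr)
    assume "\<not> j \<le> d"
    then show False using nxt_least[of t "t + int j - int d" x] assms(2) d by linarith
  qed
qed (use assms in simp)

lemma nxt_prv: "cut x t \<Longrightarrow> nxt x (t - int (prv x t)) = prv x t"
proof (rule antisym)
  assume t: "cut x t"
  let ?s = "t - int (prv x t)"
  show "nxt x ?s \<le> prv x t"
  proof (rule ccontr)
    assume "\<not> ?thesis"
    then show False using nxt_least[of ?s t x] prv(1)[of x t] t by linarith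
  qed
  show "prv x t \<le> nxt x ?s"
  proof (rule ccontr)
    assume "\<not> ?thesis"
    then show False
      using prv_least[of "?s + int (nxt x ?s)" t x] nxt(1,3)[of x ?s] by linarith
  qed
qed

lemma prv_nxt: "cut x t \<Longrightarrow> prv x (t + int (nxt x t)) = nxt x t"
proof (rule antisym)
  assume t: "cut x t"
  let ?s = "t + int (nxt x t)"
  show "prv x ?s \<le> nxt x t"
  proof (rule ccontr)
    assume "\<not> ?thesis"
    then show False using prv_least[of t ?s x] nxt(1)[of x t] t by linarith
  qed
  show "nxt x t \<le> prv x ?s"
  proof (rule ccontr)
    assume "\<not> ?thesis"
    then show False
      using nxt_least[of t "?s - int (prv x ?s)" x] prv(1,3)[of x ?s] by linarith
  qed
qed

lemma cut_shift_local: "agree (cut_radius + 2 * l) x i y k \<Longrightarrow> \<bar>d\<bar> \<le> 2 * int l \<Longrightarrow> cut x (i + d) = cut y (k + d)"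
  by (rule cut_local, erule agree_shift) simp

lemma nxt_local: "agree (cut_radius + 2 * l) x i y k \<Longrightarrow> nxt x i = nxt y k"
  unfolding nxt_def using next_cut_exists[of x i]
  by (intro Least_cong[of "2 * l"] conj_cong refl cut_shift_local) auto

lemma prv_local: "agree (cut_radius + 2 * l) x i y k \<Longrightarrow> prv x i = prv y k"
  unfolding prv_def using prev_cut_exists[of x i] cut_shift_local[of x i y k "- int _"]
  by (intro Least_cong[of "2 * l"] conj_cong refl) auto

lemma offset_local: "agree (cut_radius + 2 * l) x i y k \<Longrightarrow> offset x i = offset y k"
  unfolding offset_def using prev_cut_exists[of x i] cut_shift_local[of x i y k "- int _"]
  by (intro Least_cong[of "2 * l"]) auto

text \<open>
  The free positions form intervals whose complement consists of the positions closer than \<open>l\<close> to a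
  marker, and such a complementary interval contains a cut, namely the marker.
\<close>

lemma nxt_free_free:
  assumes "free x t" "free x (t + int (nxt x t))"
  shows "nxt x t = 1"
proof (rule ccontr)
  let ?d = "nxt x t"
  assume "?d \<noteq> 1"
  then have d: "2 \<le> ?d" using nxt(1)[of x t] by simp
  then have "\<not> cut x (t + 1)" using nxt_least[of t "t + 1" x] by simp
  then obtain k where k: "marker x k" "\<bar>k - (t + 1)\<bar> < int l"
    using not_free_marker unfolding cut_def by blast
  have "int l \<le> \<bar>k - t\<bar>" using free_marker_distance[OF assms(1) k(1)] .
  then have "k = t + int l" using k(2) by linarith
  moreover have "t + int ?d \<le> k"
  proof (rule ccontr)
    assume "\<not> ?thesis"
    then show False using nxt_least[of t k x] k(1) l N \<open>k = t + int l\<close> by (auto simp: cut_def)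
  qed
  ultimately show False using free_marker_distance[OF assms(2) k(1)] d by linarith
qed

lemma nxt_not_free_free:
  assumes "range x \<subseteq> {..<m}" "cut x t" "\<not> (free x t \<and> free x (t + int (nxt x t)))"
  shows "N \<le> nxt x t" "free x t \<or> free x (t + int (nxt x t)) \<Longrightarrow> l \<le> nxt x t"
proof -
  let ?d = "nxt x t"
  have *: "l \<le> ?d" if "free x t \<or> free x (t + int ?d)"
  proof -
    from that consider "free x t" "marker x (t + int ?d)" | "free x (t + int ?d)" "marker x t"
      using assms(2,3) nxt(3)[of x t] unfolding cut_def by blast
    then show ?thesis
      using free_marker_distance[of x t "t + int ?d"] free_marker_distance[of x "t + int ?d" t]
      by cases auto
  qed
  then show "free x t \<or> free x (t + int ?d) \<Longrightarrow> l \<le> ?d" .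
  show "N \<le> ?d"
  proof (cases "free x t \<or> free x (t + int ?d)")
    case True
    then show ?thesis using * l by linarith
  next
    case False
    then have "marker x t" "marker x (t + int ?d)" using assms(2) nxt(3)[of x t] unfolding cut_def by blast+
    then show ?thesis using markers_separated[OF assms(1)] nxt(1)[of x t] by fastforce
  qed
qed

subsection \<open>The periodic point seen at a free position\<close>

definition local_period :: "(int \<Rightarrow> nat) \<Rightarrow> int \<Rightarrow> nat" where
  "local_period x i = (SOME d. per_at x i d)"

text \<open>
  The periodic continuation of the window around \<open>i\<close>, with coordinates relative to \<open>i\<close>.
\<close>

definition per_point :: "(int \<Rightarrow> nat) \<Rightarrow> int \<Rightarrow> int \<Rightarrow> nat" where
  "per_point x i j = x (i + ((j + int K) mod int (local_period x i) - int K))"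

context
  fixes x i
  assumes x: "range x \<subseteq> {..<m}" and free: "free x i"
begin

lemma per_local_period: "per_at x i (local_period x i)"
  unfolding local_period_def using free_periodic[OF x free] by (rule someI_ex)

lemma local_period_bounds: "1 \<le> local_period x i" "local_period x i < N"
  using per_local_period by (simp_all add: per_at_def)

lemma periodic_per_point: "periodic (local_period x i) (per_point x i)"
proof -
  have "(j + int (local_period x i) + int K) mod int (local_period x i) = (j + int K) mod int (local_period x i)" for j
    by (metis add.assoc add.commute mod_add_self2)
  then show ?thesis by (simp add: periodic_def per_point_def)
qed

lemma per_point_eq: "\<bar>j\<bar> \<le> int K \<Longrightarrow> per_point x i j = x (i + j)"
proof -
  assume j: "\<bar>j\<bar> \<le> int K"
  let ?d = "local_period x i"
  have step: "x (i + (int t - int K)) = x (i + (int (t mod ?d) - int K))" if "t \<le> 2 * K" for t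
    using that
  proof (induction t rule: less_induct)
    case (less t)
    show ?case
    proof (cases "t < ?d")
      case False
      have "x (i + (int (t - ?d) - int K)) = x (i + ((int (t - ?d) - int K) + int ?d))"
        using per_local_period False less.prems unfolding per_at_def by (auto simp: of_nat_diff)
      moreover have "(t - ?d) mod ?d = t mod ?d" using False by (simp add: le_mod_geq)
      ultimately show ?thesis
        using less.IH[of "t - ?d"] False less.prems local_period_bounds by (simp add: of_nat_diff)
    qed simp
  qed
  have "int (nat (j + int K)) = j + int K" using j by linarith
  then show ?thesis using step[of "nat (j + int K)"] j
    by (simp add: per_point_def zmod_int nat_le_iff)
qed

end

lemma per_point_local:
  assumes "agree K x i y k" "range x \<subseteq> {..<m}" "free x i"
  shows "per_point x i = per_point y k"
proof
  fix j
  have "per_at y k = per_at x i" using per_at_local[OF assms(1)] by (simp add: fun_eq_iff)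
  then have d: "local_period y k = local_period x i" unfolding local_period_def by simp
  have "0 \<le> (j + int K) mod int (local_period x i)" "(j + int K) mod int (local_period x i) < int (local_period x i)"
    using local_period_bounds[OF assms(2,3)] by simp_all
  moreover have "N \<le> K" using l K(1) by simp
  ultimately show "per_point x i j = per_point y k j"
    unfolding per_point_def d using local_period_bounds[OF assms(2,3)] by (intro agreeD[OF assms(1)]) linarith
qed

lemma periodic_eq:
  assumes "periodic d u" "periodic d v" "1 \<le> d"
    and eq: "\<And>j. a \<le> j \<Longrightarrow> j < a + int d \<Longrightarrow> u j = v j"
  shows "u j = (v j :: nat)"
proof -
  have shift: "w (j + int d * q) = w j" if "periodic d w" for w :: "int \<Rightarrow> nat" and q j
  proof (cases "0 \<le> q")
    case True
    then have "periodic (d * nat q) w" using periodic_mult[OF that] by simp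
    then show ?thesis using True by (simp add: periodic_def)
  next
    case False
    then have "periodic (d * nat (- q)) w" using periodic_mult[OF that] by simp
    then have "w (j + int d * q + int (d * nat (- q))) = w (j + int d * q)" by (simp add: periodic_def)
    then show ?thesis using False by (simp add: algebra_simps)
  qed
  define j' where "j' = a + (j - a) mod int d"
  have j: "j = j' + int d * ((j - a) div int d)"
    unfolding j'_def using mult_div_mod_eq[of "int d" "j - a"] by linarith
  have "u j' = v j'" using assms(3) by (intro eq) (simp_all add: j'_def)
  then show ?thesis
    using shift[OF assms(1), of j' "(j - a) div int d"] shift[OF assms(2), of j' "(j - a) div int d"] j
    by simp
qed

text \<open>
  Both sides have the product of the two periods as a period and agree on an interval of that length.
\<close>

lemma per_point_next:
  assumes x: "range x \<subseteq> {..<m}" and free: "free x i" "free x (i + 1)"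
  shows "per_point x (i + 1) j = per_point x i (j + 1)"
proof -
  let ?d = "local_period x i" and ?e = "local_period x (i + 1)"
  have p1: "periodic (?d * ?e) (per_point x (i + 1))"
    by (rule periodic_mult[OF periodic_per_point[OF x free(2)]]) simp
  have "periodic (?d * ?e) (per_point x i)"
    by (rule periodic_mult[OF periodic_per_point[OF x free(1)]]) simp
  then have p2: "periodic (?d * ?e) (\<lambda>j. per_point x i (j + 1))"
    unfolding periodic_def by (metis add.assoc add.commute)
  have le: "?d * ?e \<le> K"
    using K(2) mult_mono[of ?d N ?e N] local_period_bounds[OF x free(1)] local_period_bounds[OF x free(2)] by simp
  show ?thesis
  proof (rule periodic_eq[OF p1 p2])
    show "1 \<le> ?d * ?e"
      using mult_le_mono[OF local_period_bounds(1)[OF x free(1)] local_period_bounds(1)[OF x free(2)]] by simp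
    fix j assume "- int K \<le> j" "j < - int K + int (?d * ?e)"
    then have "\<bar>j\<bar> \<le> int K" "\<bar>j + 1\<bar> \<le> int K" using le by linarith+
    then show "per_point x (i + 1) j = per_point x i (j + 1)"
      by (simp only: per_point_eq[OF x free(1)] per_point_eq[OF x free(2)]) (simp only: add.assoc add.commute[of 1])
  qed
qed

subsection \<open>Enumeration of the cuts\<close>

lemma enumerate_cuts:
  "\<exists>t :: int \<Rightarrow> int. (\<forall>k. cut x (t k)) \<and> (\<forall>k. t (k + 1) = t k + int (nxt x (t k)))"
proof -
  obtain t0 where t0: "cut x t0" using cut_near by blast
  define f where "f i = i + int (nxt x i)" for i
  define g where "g i = i - int (prv x i)" for i
  define t where "t k = (if 0 \<le> k then (f ^^ nat k) t0 else (g ^^ nat (- k)) t0)" for k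
  have f: "cut x ((f ^^ n) t0)" for n by (induction n) (simp_all add: f_def nxt t0)
  have g: "cut x ((g ^^ n) t0)" for n by (induction n) (simp_all add: g_def prv t0)
  have fg: "f (g i) = i" if "cut x i" for i using nxt_prv[OF that] by (simp add: f_def g_def)
  have "cut x (t k)" for k using f g by (simp add: t_def)
  moreover have "t (k + 1) = f (t k)" for k
  proof (cases "0 \<le> k")
    case True
    then have "nat (k + 1) = Suc (nat k)" by simp
    then show ?thesis using True by (simp add: t_def)
  next
    case False
    define n where "n = nat (- k - 1)"
    have "nat (- k) = Suc n" using False by (simp add: n_def)
    then have "t k = g ((g ^^ n) t0)" using False by (simp add: t_def)
    moreover have "t (k + 1) = (g ^^ n) t0"
      using False by (cases "k = - 1") (simp_all add: t_def n_def)
    ultimately show ?thesis by (simp only: fg[OF g])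
  qed
  ultimately have "(\<forall>k. cut x (t k)) \<and> (\<forall>k. t (k + 1) = t k + int (nxt x (t k)))"
    unfolding f_def by simp
  then show ?thesis by (rule exI[of _ t])
qed

end

section \<open>Normalizing a homomorphism\<close>

text \<open>
  The Curtis--Hedlund--Lyndon theorem: by compactness the coordinate at \<open>0\<close> of the image depends on
  a bounded window.
\<close>

lemma block_code_exists:
  fixes \<phi> :: "(int \<Rightarrow> nat) \<Rightarrow> int \<Rightarrow> nat"
  assumes comp: "compact X" and inv: "\<And>x. x \<in> X \<Longrightarrow> shift x \<in> X" "X \<subseteq> shift ` X"
    and cont: "continuous_on X \<phi>" and comm: "\<And>x. x \<in> X \<Longrightarrow> \<phi> (shift x) = shift (\<phi> x)"
  shows "\<exists>R f. (\<forall>u v. agree R u 0 v 0 \<longrightarrow> f u = f v) \<and> (\<forall>x\<in>X. \<forall>i. \<phi> x i = f (\<lambda>j. x (i + j)))"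
proof -
  define cyl where "cyl n x = {y :: int \<Rightarrow> nat. \<forall>j. \<bar>j\<bar> \<le> int n \<longrightarrow> y j = x j}" for n x
  have open_cyl: "open (cyl n x)" for n x
  proof -
    have "open ((\<lambda>y :: int \<Rightarrow> nat. y j) -` {x j})" for j
      by (rule open_vimage) (auto simp: open_discrete continuous_on_product_coordinates)
    moreover have "cyl n x = (\<Inter>j\<in>{- int n..int n}. (\<lambda>y. y j) -` {x j})"
      by (auto simp: cyl_def abs_le_iff)
    ultimately show ?thesis by (auto intro!: open_INT)
  qed
  have loc: "\<exists>n. \<forall>y\<in>X \<inter> cyl n x. \<phi> y 0 = \<phi> x 0" if x: "x \<in> X" for x
  proof -
    have "continuous_on X (\<lambda>y. \<phi> y 0)"
      using continuous_on_product_then_coordinatewise[OF cont] .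
    then have "\<exists>A. open A \<and> A \<inter> X = (\<lambda>y. \<phi> y 0) -` {\<phi> x 0} \<inter> X"
      unfolding continuous_on_open_invariant by (auto simp: open_discrete)
    then obtain A where A: "open A" "A \<inter> X = (\<lambda>y. \<phi> y 0) -` {\<phi> x 0} \<inter> X" by blast
    have "x \<in> A" using A(2) x by blast
    with A(1) have "\<exists>U. finite {i. U i \<noteq> UNIV} \<and> (\<forall>i. open (U i)) \<and> x \<in> Pi\<^sub>E UNIV U \<and> Pi\<^sub>E UNIV U \<subseteq> A"
      unfolding open_fun_def openin_product_topology_alt by auto
    then obtain U where U: "finite {i. U i \<noteq> UNIV}" "x \<in> Pi\<^sub>E UNIV U" "Pi\<^sub>E UNIV U \<subseteq> A"
      by blast
    obtain n where n: "\<And>i. U i \<noteq> UNIV \<Longrightarrow> \<bar>i\<bar> \<le> int n"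
    proof
      fix i assume "U i \<noteq> UNIV"
      then have "\<bar>i\<bar> \<le> Max (abs ` {i. U i \<noteq> UNIV})" using U(1) by (intro Max_ge) auto
      then show "\<bar>i\<bar> \<le> int (nat (Max (abs ` {i. U i \<noteq> UNIV})))" by linarith
    qed
    have "y \<in> A" if "y \<in> cyl n x" for y
    proof -
      have "y i \<in> U i" for i
      proof (cases "U i = UNIV")
        case False
        then have "y i = x i" using n that by (simp add: cyl_def)
        moreover have "x i \<in> U i" using U(2) by (auto simp: PiE_def)
        ultimately show ?thesis by simp
      qed simp
      then show ?thesis using U(3) by (auto simp: PiE_def)
    qed
    then show ?thesis using A(2) by (intro exI[of _ n]) blast
  qed
  then obtain n where n: "\<And>x y. x \<in> X \<Longrightarrow> y \<in> X \<Longrightarrow> y \<in> cyl (n x) x \<Longrightarrow> \<phi> y 0 = \<phi> x 0"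
    by (metis IntI)
  have cover: "X \<subseteq> (\<Union>x\<in>X. cyl (n x) x)" by (auto simp: cyl_def)
  obtain D where D: "D \<subseteq> X" "finite D" "X \<subseteq> (\<Union>x\<in>D. cyl (n x) x)"
    by (rule compactE_image[OF comp open_cyl cover])
  define R where "R = Max (insert 0 (n ` D))"
  have R: "n x \<le> R" if "x \<in> D" for x using that D(2) unfolding R_def by (intro Max_ge) auto
  have unif: "\<phi> x 0 = \<phi> y 0" if xy: "x \<in> X" "y \<in> X" "agree R x 0 y 0" for x y
  proof -
    obtain p where p: "p \<in> D" "x \<in> cyl (n p) p" using D(3) xy(1) by blast
    have "y j = x j" if "\<bar>j\<bar> \<le> int (n p)" for j
      using agreeD[OF xy(3), of j] R[OF p(1)] that by simp
    then have "y \<in> cyl (n p) p" using p(2) unfolding cyl_def by simp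
    then show ?thesis using n[of p] p D(1) xy by (metis subsetD)
  qed
  define f where "f u = \<phi> (SOME x. x \<in> X \<and> agree R u 0 x 0) 0" for u
  have "f u = f v" if "agree R u 0 v 0" for u v
  proof -
    have "agree R u 0 x 0 = agree R v 0 x 0" for x :: "int \<Rightarrow> nat"
      using that unfolding agree_def by auto
    then show ?thesis by (simp add: f_def)
  qed
  moreover have "\<phi> x i = f (\<lambda>j. x (i + j))" if xX: "x \<in> X" for x i
  proof -
    have up: "(\<lambda>j. x (int n + j)) \<in> X \<and> \<phi> (\<lambda>j. x (int n + j)) = (\<lambda>j. \<phi> x (int n + j))" if "x \<in> X" for x n
    proof (induction n)
      case (Suc n)
      have *: "(\<lambda>j. z (int (Suc n) + j)) = shift (\<lambda>j. z (int n + j))" for z :: "int \<Rightarrow> nat"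
        by (simp add: shift_def algebra_simps)
      show ?case unfolding * using Suc inv(1) comm by simp
    qed (use that in simp)
    have down: "\<exists>y\<in>X. x = (\<lambda>j. y (int n + j))" if "x \<in> X" for x n
    proof (induction n)
      case 0
      show ?case using that by (intro bexI[of _ x]) simp_all
    next
      case (Suc n)
      then obtain y where y: "y \<in> X" "x = (\<lambda>j. y (int n + j))" by blast
      obtain z where "z \<in> X" "y = shift z" using inv(2) y(1) by blast
      then show ?case using y(2) by (intro bexI[of _ z]) (simp_all add: shift_def algebra_simps)
    qed
    have sh: "(\<lambda>j. x (i + j)) \<in> X \<and> \<phi> (\<lambda>j. x (i + j)) 0 = \<phi> x i"
    proof (cases "0 \<le> i")
      case True
      then show ?thesis using up[OF xX, of "nat i"] by simp
    next
      case False
      obtain y where y: "y \<in> X" "x = (\<lambda>j. y (int (nat (- i)) + j))" using down[OF xX] by blast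
      have "\<phi> x = (\<lambda>j. \<phi> y (int (nat (- i)) + j))" using up[OF y(1), of "nat (- i)"] y(2) by simp
      moreover have "(\<lambda>j. x (i + j)) = y" using y(2) False by simp
      ultimately show ?thesis using y(1) False by simp
    qed
    have "\<exists>y. y \<in> X \<and> agree R (\<lambda>j. x (i + j)) 0 y 0" using sh by (auto simp: agree_def)
    from someI_ex[OF this] show ?thesis
      unfolding f_def using sh unif by metis
  qed
  ultimately show ?thesis by blast
qed

text \<open>
  A homomorphism \<open>\<phi>\<close> with block code \<open>f\<close> of radius \<open>R\<close>.  The number \<open>R\<close> is unrelated to the parameters of
  the markers.
\<close>

locale normalization = markers N l K m r color
  for N l K m r :: nat and color :: "nat list \<Rightarrow> nat" +
  fixes G H :: "nat labelled_graph" and n n' R :: nat and \<phi> :: "(int \<Rightarrow> nat) \<Rightarrow> int \<Rightarrow> nat"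
    and f :: "(int \<Rightarrow> nat) \<Rightarrow> nat"
  assumes G: "vertices_below G n" and H: "vertices_below H n'"
    and labels: "labels_below G m"
    and types: "2 ^ (n * n) \<le> N" "2 ^ (2 ^ (n' * n')) \<le> N" and long: "N * N \<le> l"
    and into: "\<And>x. x \<in> label_sequences G \<Longrightarrow> \<phi> x \<in> label_sequences H"
    and f_agree: "\<And>u v. agree R u 0 v 0 \<Longrightarrow> f u = f v"
    and code: "\<And>x i. x \<in> label_sequences G \<Longrightarrow> \<phi> x i = f (\<lambda>j. x (i + j))"
begin

text \<open>
  All lengths added by pumping are multiples of \<open>E\<close>.  It is divisible by every period \<open>d < N\<close>, by
  \<open>d * fact (2 ^ (n * n))\<close> as demanded by \<open>wtype_periodic\<close>, and by the factorial in \<open>shrink_word\<close>.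
\<close>

definition E :: nat where "E = fact N * fact N"

lemma E_pos: "0 < E" by (simp add: E_def)

definition pump :: "nat list \<Rightarrow> nat list" where
  "pump w = (SOME w'. wtype G n w' = wtype G n w \<and> R \<le> length w' \<and> length w \<le> length w' \<and>
    E dvd length w' - length w)"

lemma pump:
  assumes "N \<le> length w"
  shows "wtype G n (pump w) = wtype G n w" "R \<le> length (pump w)" "length w \<le> length (pump w)"
    "E dvd length (pump w) - length w"
proof -
  have "2 ^ (n * n) \<le> length w" using assms types(1) by linarith
  from someI_ex[OF pump_word[OF G this E_pos, of R]]
  show "wtype G n (pump w) = wtype G n w" "R \<le> length (pump w)" "length w \<le> length (pump w)"
    "E dvd length (pump w) - length w" unfolding pump_def[symmetric] by simp_all
qed

text \<open>
  A piece with one free end is extended along the periodic point seen at that end.  The pumped point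
  then agrees with this periodic point up to distance \<open>R\<close> on both sides of the free end, which is what
  \<open>left_ctx\<close> and \<open>right_ctx\<close> rely on.  A piece between two free positions has length one; its length
  need not change.
\<close>

definition pumped :: "(int \<Rightarrow> nat) \<Rightarrow> int \<Rightarrow> nat list" where
  "pumped x t = (let d = nxt x t in
     if free x t then (if free x (t + int d) then [x t] else word (per_point x t) 0 (d + E * R))
     else if free x (t + int d) then word (per_point x (t + int d)) (- int d) (d + E * R)
     else pump (word x t d))"

lemma label_range: "x \<in> label_sequences G \<Longrightarrow> range x \<subseteq> {..<m}"
  using labels by (fastforce simp: label_sequences_def labels_below_def)

lemma local_period_dvd_E: "range x \<subseteq> {..<m} \<Longrightarrow> free x i \<Longrightarrow> local_period x i dvd E"
  using local_period_bounds[of x i] by (auto simp: E_def intro!: dvd_mult2 dvd_fact)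

lemma wtype_per_point:
  assumes x: "range x \<subseteq> {..<m}" "free x i" and d: "l \<le> d"
  shows "wtype G n (word (per_point x i) j (d + E * R)) = wtype G n (word (per_point x i) j d)"
proof (rule wtype_periodic[OF G periodic_per_point[OF x]])
  have "local_period x i * 2 ^ (n * n) \<le> N * N"
    using local_period_bounds[OF x] types(1) by (intro mult_le_mono) auto
  then show "local_period x i * 2 ^ (n * n) \<le> d" using long d by linarith
  have "local_period x i dvd fact N" using local_period_bounds[OF x] by (intro dvd_fact) auto
  moreover have "fact (2 ^ (n * n)) dvd (fact N :: nat)" by (rule fact_dvd[OF types(1)])
  ultimately show "local_period x i * fact (2 ^ (n * n)) dvd E * R"
    unfolding E_def by (intro dvd_mult2 mult_dvd_mono)
qed

lemma pumped_spec:
  assumes x: "range x \<subseteq> {..<m}" and t: "cut x t"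
  shows "wtype G n (pumped x t) = wtype G n (word x t (nxt x t))" (is ?type)
    and "\<not> (free x t \<and> free x (t + int (nxt x t))) \<Longrightarrow>
      N \<le> nxt x t \<and> R \<le> length (pumped x t) \<and> nxt x t \<le> length (pumped x t) \<and> E dvd length (pumped x t) - nxt x t"
      (is "_ \<Longrightarrow> ?long")
    and "pumped x t \<noteq> []" (is ?ne)
proof -
  let ?d = "nxt x t"
  have dK: "int ?d \<le> int K" using nxt(2)[of x t] K(1) by linarith
  have ER: "R \<le> E * R" using E_pos by (cases E) auto
  have "?type \<and> (\<not> (free x t \<and> free x (t + int ?d)) \<longrightarrow> ?long) \<and> ?ne"
  proof (cases "free x t")
    case ft: True
    show ?thesis
    proof (cases "free x (t + int ?d)")
      case True
      then have "?d = 1" using nxt_free_free ft by blast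
      then show ?thesis using True ft by (simp add: pumped_def word_def)
    next
      case False
      have N: "N \<le> ?d" "l \<le> ?d" using nxt_not_free_free[OF x t] ft False by blast+
      have "word (per_point x t) 0 ?d = word x t ?d"
        using dK by (intro word_cong) (simp add: per_point_eq[OF x ft])
      moreover have "pumped x t = word (per_point x t) 0 (?d + E * R)" using ft False by (simp add: pumped_def)
      ultimately have len: "length (pumped x t) = ?d + E * R" and ty: ?type
        using wtype_per_point[OF x ft N(2), of 0] by simp_all
      have "?ne" using len nxt(1)[of x t] by auto
      moreover have "R \<le> length (pumped x t)" using len ER by linarith
      ultimately show ?thesis using ty N(1) len by simp
    qed
  next
    case nf: False
    show ?thesis
    proof (cases "free x (t + int ?d)")
      case True
      have N: "N \<le> ?d" "l \<le> ?d" using nxt_not_free_free[OF x t] nf True by blast+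
      have "word (per_point x (t + int ?d)) (- int ?d) ?d = word x t ?d"
        using dK by (intro word_cong) (simp add: per_point_eq[OF x True])
      moreover have "pumped x t = word (per_point x (t + int ?d)) (- int ?d) (?d + E * R)"
        using nf True by (simp add: pumped_def Let_def)
      ultimately have len: "length (pumped x t) = ?d + E * R" and ty: ?type
        using wtype_per_point[OF x True N(2), of "- int ?d"] by simp_all
      have "?ne" using len nxt(1)[of x t] by auto
      moreover have "R \<le> length (pumped x t)" using len ER by linarith
      ultimately show ?thesis using ty N(1) len by simp
    next
      case False
      have N: "N \<le> ?d" using nxt_not_free_free[OF x t] nf False by blast
      have "pumped x t = pump (word x t ?d)" using nf False by (simp add: pumped_def)
      moreover have "N \<le> length (word x t ?d)" using N by simp
      moreover have "length (pumped x t) \<noteq> 0"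
        using pump(3)[OF calculation(2)] calculation(1) nxt(1)[of x t] by auto
      ultimately show ?thesis using pump[of "word x t ?d"] N by auto
    qed
  qed
  then show ?type "\<not> (free x t \<and> free x (t + int ?d)) \<Longrightarrow> ?long" ?ne by blast+
qed

text \<open>
  The \<open>R\<close> symbols on either side of a cut in the pumped point, expressed through \<open>x\<close> near that cut.  At
  a free cut they come from the periodic point, however many pieces they extend over; at a marker the
  adjacent piece is long enough to contain them.
\<close>

definition left_ctx :: "(int \<Rightarrow> nat) \<Rightarrow> int \<Rightarrow> int \<Rightarrow> nat" where
  "left_ctx x t j = (if free x t then per_point x t j
     else let w = pumped x (t - int (prv x t)) in w ! nat (int (length w) + j))"

definition right_ctx :: "(int \<Rightarrow> nat) \<Rightarrow> int \<Rightarrow> int \<Rightarrow> nat" where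
  "right_ctx x t j = (if free x t then per_point x t j else pumped x t ! nat j)"

definition ctx :: "(int \<Rightarrow> nat) \<Rightarrow> int \<Rightarrow> int \<Rightarrow> nat" where
  "ctx x t j = (if j < 0 then left_ctx x t j
     else if j < int (length (pumped x t)) then pumped x t ! nat j
     else right_ctx x (t + int (nxt x t)) (j - int (length (pumped x t))))"

definition out :: "(int \<Rightarrow> nat) \<Rightarrow> int \<Rightarrow> nat list" where
  "out x t = map (\<lambda>i. f (\<lambda>j. ctx x t (int i + j))) [0..<length (pumped x t)]"

text \<open>
  The output over a piece after shrinking; the choice depends only on the length of the piece and the
  type of \<open>out x t\<close>, so it does not spoil locality.
\<close>

definition shrunk :: "(int \<Rightarrow> nat) \<Rightarrow> int \<Rightarrow> nat list" where
  "shrunk x t = (SOME w. length w = nxt x t \<and> wtype H n' w = wtype H n' (out x t))"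

definition \<psi> :: "(int \<Rightarrow> nat) \<Rightarrow> int \<Rightarrow> nat" where
  "\<psi> x i = shrunk x (i - int (offset x i)) ! offset x i"

subsection \<open>Locality of the normalized map\<close>

context
  fixes x y :: "int \<Rightarrow> nat"
  assumes x: "range x \<subseteq> {..<m}" and y: "range y \<subseteq> {..<m}"
begin

lemma pumped_local:
  assumes a: "agree (cut_radius + 2 * l) x t y s"
  shows "pumped x t = pumped y s"
proof -
  let ?d = "nxt x t"
  have d: "nxt y s = ?d" using nxt_local[OF a] by simp
  have dl: "int ?d \<le> 2 * int l" using nxt(2)[of x t] by linarith
  have a': "agree cut_radius x (t + int ?d) y (s + int ?d)"
    by (rule agree_shift[OF a]) (use dl in simp)
  have a0: "agree cut_radius x t y s" using a by (rule agree_mono) simp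
  have z: "per_point x t = per_point y s" if "free x t"
    by (rule per_point_local[OF agree_mono[OF a0] x that]) simp
  have z': "per_point x (t + int ?d) = per_point y (s + int ?d)" if "free x (t + int ?d)"
    by (rule per_point_local[OF agree_mono[OF a'] x that]) simp
  have w: "word x t ?d = word y s ?d"
  proof (intro word_cong agreeD[OF a])
    fix j assume "j < ?d"
    then have "int j \<le> 2 * int l" using dl by linarith
    also have "\<dots> \<le> int (cut_radius + 2 * l)" by simp
    finally show "\<bar>int j\<bar> \<le> int (cut_radius + 2 * l)" by simp
  qed
  have xt: "x t = y s" using agreeD[OF a, of 0] by simp
  show ?thesis
    unfolding pumped_def Let_def d free_local[OF a0, symmetric] free_local[OF a', symmetric] w
    using z z' xt by simp
qed

lemma left_ctx_local:
  assumes a: "agree (cut_radius + 4 * l) x t y s"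
  shows "left_ctx x t = left_ctx y s"
proof -
  have a2: "agree (cut_radius + 2 * l) x t y s" using a by (rule agree_mono) simp
  have a0: "agree cut_radius x t y s" using a by (rule agree_mono) simp
  have "agree (cut_radius + 2 * l) x (t - int (prv x t)) y (s - int (prv x t))"
    using agree_shift[OF a, of "- int (prv x t)"] prv(2)[of x t] by simp
  from pumped_local[OF this] have "pumped x (t - int (prv x t)) = pumped y (s - int (prv y s))"
    by (simp add: prv_local[OF a2])
  moreover have "per_point x t = per_point y s" if "free x t"
    by (rule per_point_local[OF agree_mono[OF a0] x that]) simp
  ultimately show ?thesis unfolding left_ctx_def fun_eq_iff using free_local[OF a0] by simp
qed

lemma right_ctx_local:
  assumes a: "agree (cut_radius + 2 * l) x t y s"
  shows "right_ctx x t = right_ctx y s"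
proof -
  have a0: "agree cut_radius x t y s" using a by (rule agree_mono) simp
  have "per_point x t = per_point y s" if "free x t"
    by (rule per_point_local[OF agree_mono[OF a0] x that]) simp
  then show ?thesis unfolding right_ctx_def fun_eq_iff using free_local[OF a0] pumped_local[OF a] by simp
qed

lemma ctx_local:
  assumes a: "agree (cut_radius + 4 * l) x t y s"
  shows "ctx x t = ctx y s"
proof -
  have a2: "agree (cut_radius + 2 * l) x t y s" using a by (rule agree_mono) simp
  have "agree (cut_radius + 2 * l) x (t + int (nxt x t)) y (s + int (nxt x t))"
    by (rule agree_shift[OF a]) (use nxt(2)[of x t] in simp)
  from right_ctx_local[OF this]
  have "right_ctx x (t + int (nxt x t)) = right_ctx y (s + int (nxt y s))"
    by (simp add: nxt_local[OF a2])
  then show ?thesis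
    unfolding ctx_def fun_eq_iff using pumped_local[OF a2] left_ctx_local[OF a] by simp
qed

lemma shrunk_local:
  assumes a: "agree (cut_radius + 4 * l) x t y s"
  shows "shrunk x t = shrunk y s"
proof -
  have a2: "agree (cut_radius + 2 * l) x t y s" using a by (rule agree_mono) simp
  show ?thesis
    unfolding shrunk_def out_def by (simp add: ctx_local[OF a] pumped_local[OF a2] nxt_local[OF a2])
qed

lemma psi_local:
  assumes a: "agree (cut_radius + 6 * l) x i y k"
  shows "\<psi> x i = \<psi> y k"
proof -
  have a2: "agree (cut_radius + 2 * l) x i y k" using a by (rule agree_mono) simp
  have "agree (cut_radius + 4 * l) x (i - int (offset x i)) y (k - int (offset x i))"
    using agree_shift[OF a, of "- int (offset x i)"] offset_le[of x i] by simp
  from shrunk_local[OF this] show ?thesis unfolding \<psi>_def by (simp add: offset_local[OF a2])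
qed

end

subsection \<open>The normalized map lands in the target\<close>

text \<open>
  The pumped point \<open>x'\<close> is assembled from all the pieces, and its image \<open>\<phi> x'\<close> has a path through \<open>H\<close>.
  The vertices of that path at the cuts of \<open>x'\<close> serve as the vertices at the cuts of \<open>x\<close>.
\<close>

lemma psi_into:
  assumes xG: "x \<in> label_sequences G"
  shows "\<psi> x \<in> label_sequences H"
proof -
  have x: "range x \<subseteq> {..<m}" using label_range[OF xG] .
  obtain v where v: "\<And>i. (v i, x i, v (i + 1)) \<in> set G" using xG by (auto simp: label_sequences_def)
  obtain t :: "int \<Rightarrow> int" where t: "\<And>k. cut x (t k)" "\<And>k. t (k + 1) = t k + int (nxt x (t k))"
    using enumerate_cuts[of x] by blast
  have cuts_t: "cuts t" unfolding cuts_def using t(2) nxt(1)[of x] by (simp add: Suc_le_eq)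
  let ?pumped = "\<lambda>k. pumped x (t k)"
  obtain s where s: "\<And>k. s (k + 1) = s k + int (length (?pumped k))"
    using cuts_from_gaps[of "\<lambda>k. int (length (?pumped k))"] by blast
  have nonempty: "?pumped k \<noteq> []" for k by (rule pumped_spec(3)[OF x t(1)])
  have cuts_s: "cuts s" unfolding cuts_def using s nonempty by simp
  obtain x' where x': "\<And>k. word x' (s k) (length (?pumped k)) = ?pumped k"
    using glue_words[OF cuts_s s] by blast
  have x'_nth: "x' (s k + int i) = ?pumped k ! i" if "i < length (?pumped k)" for k i
    using arg_cong[OF x'[of k], of "\<lambda>w. w ! i"] that by simp
  have x'_nth': "x' (s k + j) = ?pumped k ! nat j" if "0 \<le> j" "j < int (length (?pumped k))" for k j
    using x'_nth[of "nat j" k] that by (simp add: nat_less_iff)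
  have "x' \<in> label_sequences G"
  proof (rule glue_walk[OF cuts_s])
    fix k
    have "walk G (v (t k)) (word x (t k) (nxt x (t k))) (v (t k + int (nxt x (t k))))"
      by (rule label_sequences_walk) (rule v)
    then have "walk G (v (t k)) (?pumped k) (v (t (k + 1)))"
      unfolding t(2) using nxt(1)[of x "t k"] nonempty
      by (intro walk_wtype_cong[OF G pumped_spec(1)[OF x t(1), symmetric]]) (auto simp: word_def)
    then show "walk G (v (t k)) (word x' (s k) (nat (s (k + 1) - s k))) (v (t (k + 1)))"
      by (simp add: s x')
  qed
  then have phi: "\<phi> x' \<in> label_sequences H" "\<And>i. \<phi> x' i = f (\<lambda>j. x' (i + j))"
    using into code by blast+

  have prev: "t (k - 1) + int (nxt x (t (k - 1))) = t k" "s k = s (k - 1) + int (length (?pumped (k - 1)))"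
    "prv x (t k) = nxt x (t (k - 1))" for k
    using t(2)[of "k - 1"] s[of "k - 1"] prv_nxt[OF t(1), of "k - 1"] by simp_all
  have ff: "?pumped k = [x (t k)]" "t (k + 1) = t k + 1" "s (k + 1) = s k + 1"
    if "free x (t k)" "free x (t (k + 1))" for k
  proof -
    show "?pumped k = [x (t k)]" using that by (simp add: pumped_def Let_def t(2))
    then show "s (k + 1) = s k + 1" using s[of k] by simp
    show "t (k + 1) = t k + 1" using nxt_free_free[of x "t k"] that by (simp add: t(2))
  qed
  \<comment> \<open>Only the pieces of length one between free cuts can be shorter than \<open>R\<close>.\<close>
  have notff: "R \<le> length (?pumped k)" if "\<not> (free x (t k) \<and> free x (t (k + 1)))" for k
    using pumped_spec(2)[OF x t(1)] that by (simp add: t(2))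
  \<comment> \<open>A free cut is followed by single symbols until a periodic piece of length at least \<open>R\<close> leads to a marker.\<close>
  have right_per_point: "x' (s k + int j) = per_point x (t k) (int j)" if "free x (t k)" "j < R" for j k
    using that
  proof (induction j arbitrary: k)
    case 0
    have "x' (s k) = ?pumped k ! 0" using x'_nth[of 0 k] nonempty by simp
    also have "\<dots> = per_point x (t k) 0"
    proof (cases "free x (t (k + 1))")
      case True
      then show ?thesis using ff 0 by (simp add: per_point_eq[OF x 0(1)])
    next
      case False
      then have "?pumped k = word (per_point x (t k)) 0 (nxt x (t k) + E * R)"
        using 0 by (simp add: pumped_def Let_def t(2))
      then show ?thesis using nxt(1)[of x "t k"] by simp
    qed
    finally show ?case by simp
  next
    case (Suc j)
    show ?case
    proof (cases "free x (t (k + 1))")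
      case True
      have "x' (s k + int (Suc j)) = x' (s (k + 1) + int j)"
        using ff(3)[OF Suc.prems(1) True] by (simp add: algebra_simps)
      also have "\<dots> = per_point x (t (k + 1)) (int j)" using Suc True by simp
      also have "\<dots> = per_point x (t k) (int j + 1)"
        using per_point_next[OF x Suc.prems(1)] True ff(2)[OF Suc.prems(1) True] by simp
      finally show ?thesis by (simp add: add.commute)
    next
      case False
      then have "?pumped k = word (per_point x (t k)) 0 (nxt x (t k) + E * R)"
        using Suc.prems by (simp add: pumped_def Let_def t(2))
      moreover have "Suc j < length (?pumped k)" using notff[of k] False Suc.prems by simp
      ultimately show ?thesis using x'_nth[of "Suc j" k] by simp
    qed
  qed
  have left_per_point: "x' (s k - int (Suc j)) = per_point x (t k) (- int (Suc j))" if "free x (t k)" "Suc j \<le> R" for j k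
    using that
  proof (induction j arbitrary: k)
    case 0
    show ?case
    proof (cases "free x (t (k - 1))")
      case True
      have k: "free x (t (k - 1 + 1))" using 0 by simp
      note ff' = ff[OF True k]
      have "x' (s k - 1) = x (t (k - 1))" using ff' x'_nth[of 0 "k - 1"] by simp
      also have "\<dots> = per_point x (t k) (- 1)"
        using ff'(2) per_point_eq[OF x 0(1), of "- 1"] N l K by simp
      finally show ?thesis by simp
    next
      case False
      let ?d = "nxt x (t (k - 1))"
      have pk: "?pumped (k - 1) = word (per_point x (t k)) (- int ?d) (?d + E * R)"
        using 0 False by (simp add: pumped_def Let_def prev(1))
      have ER: "1 \<le> E * R" using E_pos 0 by simp
      have "x' (s k - 1) = ?pumped (k - 1) ! (?d + E * R - 1)"
        using x'_nth[of "?d + E * R - 1" "k - 1"] ER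
        by (simp add: prev(2)[of k] pk of_nat_diff algebra_simps del: of_nat_mult nth_word)
      also have "\<dots> = per_point x (t k) (- 1 + int (E * R))"
      proof -
        have "int (?d + E * R - 1) = int ?d + int (E * R) - 1" using ER by linarith
        moreover have "?d + E * R - 1 < ?d + E * R" using ER by linarith
        ultimately show ?thesis by (simp only: pk nth_word) (simp add: algebra_simps)
      qed
      also have "\<dots> = per_point x (t k) (- 1)"
        using periodic_mult[OF periodic_per_point[OF x 0(1)], of "E * R"] local_period_dvd_E[OF x 0(1)]
        unfolding periodic_def by (metis dvd_mult2)
      finally show ?thesis by simp
    qed
  next
    case (Suc j)
    show ?case
    proof (cases "free x (t (k - 1))")
      case True
      have k: "free x (t (k - 1 + 1))" using Suc by simp
      note ff' = ff[OF True k]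
      have "x' (s k - int (Suc (Suc j))) = x' (s (k - 1) - int (Suc j))"
        using ff' by (simp add: algebra_simps)
      also have "\<dots> = per_point x (t (k - 1)) (- int (Suc j))" using Suc True by simp
      also have "\<dots> = per_point x (t k) (- int (Suc (Suc j)))"
        using per_point_next[OF x True, of "- int (Suc (Suc j))"] ff'(2) Suc.prems(1) by simp
      finally show ?thesis .
    next
      case False
      let ?d = "nxt x (t (k - 1))"
      have pk: "?pumped (k - 1) = word (per_point x (t k)) (- int ?d) (?d + E * R)"
        using Suc False by (simp add: pumped_def Let_def prev(1))
      have "R \<le> E * R" using E_pos by (cases E) auto
      then have ER: "Suc (Suc j) \<le> E * R" using Suc.prems(2) by linarith
      have "x' (s k - int (Suc (Suc j))) = ?pumped (k - 1) ! (?d + E * R - Suc (Suc j))"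
        using x'_nth[of "?d + E * R - Suc (Suc j)" "k - 1"] ER
        by (simp add: prev(2)[of k] pk of_nat_diff algebra_simps)
      also have "\<dots> = per_point x (t k) (- int (Suc (Suc j)) + int (E * R))"
        using ER by (simp add: pk of_nat_diff algebra_simps)
      also have "\<dots> = per_point x (t k) (- int (Suc (Suc j)))"
        using periodic_mult[OF periodic_per_point[OF x Suc.prems(1)], of "E * R"] local_period_dvd_E[OF x Suc.prems(1)]
        unfolding periodic_def by (metis dvd_mult2)
      finally show ?thesis .
    qed
  qed
  have right: "x' (s k + j) = right_ctx x (t k) j" if "0 \<le> j" "j < int R" for k j
  proof (cases "free x (t k)")
    case True
    then show ?thesis using right_per_point[of k "nat j"] that by (simp add: right_ctx_def nat_less_iff)
  next
    case False
    then show ?thesis using notff[of k] x'_nth'[of j k] that by (simp add: right_ctx_def)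
  qed
  have left: "x' (s k + j) = left_ctx x (t k) j" if "- int R \<le> j" "j < 0" for k j
  proof (cases "free x (t k)")
    case True
    have "int (Suc (nat (- j - 1))) = - j" using that by simp
    then show ?thesis using left_per_point[of k "nat (- j - 1)"] that True
      by (simp add: left_ctx_def nat_le_iff)
  next
    case False
    then have "R \<le> length (?pumped (k - 1))" using notff[of "k - 1"] by simp
    then have "x' (s (k - 1) + (int (length (?pumped (k - 1))) + j)) =
        ?pumped (k - 1) ! nat (int (length (?pumped (k - 1))) + j)"
      using that by (intro x'_nth') auto
    moreover have "t k - int (prv x (t k)) = t (k - 1)" using prev(1)[of k] prev(3)[of k] by simp
    ultimately show ?thesis using False
      by (simp add: left_ctx_def Let_def prev(2)[of k] add.assoc)
  qed
  have ctx: "x' (s k + j) = ctx x (t k) j" if "- int R \<le> j" "j < int (length (?pumped k)) + int R" for k j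
  proof -
    consider "j < 0" | "0 \<le> j" "j < int (length (?pumped k))" | "int (length (?pumped k)) \<le> j" by linarith
    then show ?thesis
    proof cases
      case 1
      then show ?thesis using left that by (simp add: ctx_def)
    next
      case 2
      then show ?thesis using x'_nth' by (simp add: ctx_def)
    next
      case 3
      then show ?thesis
        using right[of "j - int (length (?pumped k))" "k + 1"] that by (simp add: ctx_def s t(2))
    qed
  qed
  have out: "word (\<phi> x') (s k) (length (?pumped k)) = out x (t k)" for k
  proof (rule nth_equalityI)
    fix i assume "i < length (word (\<phi> x') (s k) (length (?pumped k)))"
    then have i: "i < length (?pumped k)" by simp
    have "agree R (\<lambda>j. x' (s k + int i + j)) 0 (\<lambda>j. ctx x (t k) (int i + j)) 0"
      unfolding agree_def using ctx[of "int i + _" k] i by (auto simp: add.assoc)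
    then show "word (\<phi> x') (s k) (length (?pumped k)) ! i = out x (t k) ! i"
      using i f_agree by (simp add: phi(2) out_def)
  qed (simp add: out_def)
  have len_out: "length (out x (t k)) = length (?pumped k)" for k by (simp add: out_def)
  have shrunk: "length (shrunk x (t k)) = nxt x (t k) \<and>
      wtype H n' (shrunk x (t k)) = wtype H n' (out x (t k))" for k
    unfolding shrunk_def
  proof (rule someI_ex)
    show "\<exists>w. length w = nxt x (t k) \<and> wtype H n' w = wtype H n' (out x (t k))"
    proof (cases "free x (t k) \<and> free x (t (k + 1))")
      case True
      then have "length (out x (t k)) = nxt x (t k)"
        using ff(1)[of k] nxt_free_free[of x "t k"] len_out by (simp add: t(2))
      then show ?thesis by blast
    next
      case False
      then have pumped: "N \<le> nxt x (t k)" "nxt x (t k) \<le> length (?pumped k)" "E dvd length (?pumped k) - nxt x (t k)"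
        using pumped_spec(2)[OF x t(1)] by (simp_all add: t(2))
      show ?thesis
      proof (rule shrink_word[OF H])
        show "2 ^ (2 ^ (n' * n')) \<le> nxt x (t k)" using pumped(1) types(2) by linarith
        show "length (out x (t k)) = nxt x (t k) + (length (?pumped k) - nxt x (t k))"
          using pumped(2) len_out by simp
        have "fact (2 ^ (2 ^ (n' * n'))) dvd E"
          unfolding E_def by (intro dvd_mult2 fact_dvd types(2))
        then show "fact (2 ^ (2 ^ (n' * n'))) dvd length (?pumped k) - nxt x (t k)"
          using pumped(3) by (rule dvd_trans)
      qed
    qed
  qed
  \<comment> \<open>The path of the image of the pumped point is reused at the cuts.\<close>
  obtain u where u: "\<And>i. (u i, \<phi> x' i, u (i + 1)) \<in> set H" using phi(1) by (auto simp: label_sequences_def)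
  show ?thesis
  proof (rule glue_walk[OF cuts_t])
    fix k
    have "walk H (u (s k)) (out x (t k)) (u (s (k + 1)))"
      using label_sequences_walk[of u "\<phi> x'" H "s k" "length (?pumped k)"] u by (simp add: out s)
    then have p: "walk H (u (s k)) (shrunk x (t k)) (u (s (k + 1)))"
      using nxt(1)[of x "t k"] len_out[of k] nonempty[of k] conjunct1[OF shrunk[of k]]
      by (intro walk_wtype_cong[OF H conjunct2[OF shrunk[of k], symmetric]]) auto
    have "word (\<psi> x) (t k) (nxt x (t k)) = shrunk x (t k)"
      using conjunct1[OF shrunk[of k]] by (intro nth_equalityI) (simp_all add: \<psi>_def offset_eq[OF t(1)])
    then show "walk H (u (s k)) (word (\<psi> x) (t k) (nat (t (k + 1) - t k))) (u (s (k + 1)))"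
      using p by (simp add: t(2))
  qed
qed

end

section \<open>An explicit bound on the radius\<close>

text \<open>
  The separation of the markers: at least the number of types for the first graph, and at least the
  number of sets of types for the second one.
\<close>

definition gap :: "nat \<Rightarrow> nat \<Rightarrow> nat" where
  "gap m m' = 2 ^ (m * m) + 2 ^ (2 ^ (m' * m'))"

text \<open>
  The value \<open>cut_radius + 6 * l\<close> of \<open>psi_local\<close> for \<open>l = N * N\<close>, \<open>K = 2 * l\<close> and one colour per word of
  length \<open>2 * K + 1\<close>.
\<close>

definition radius :: "nat \<Rightarrow> nat \<Rightarrow> nat" where
  "radius m N = 2 * (N * N) + N * m ^ (2 * (2 * (N * N)) + 1) + 7 * (N * N)"

lemma compact_label_sequences: "compact (label_sequences (G :: nat labelled_graph))"
proof -
  define A where "A = (fst \<circ> snd) ` set G"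
  have A: "finite A" by (simp add: A_def)
  have "finite_presentation A G (label_sequences G)"
    by (auto simp: finite_presentation_def A_def image_iff)
      (metis fst_conv snd_conv)
  then have "subshift A (label_sequences G)"
    using finite_presentation_imp_sofic[OF A] unfolding sofic_def by blast
  then have "closed (label_sequences G)" "label_sequences G \<subseteq> {x. range x \<subseteq> A}"
    unfolding subshift_def by blast+
  then show ?thesis using compact_Int_closed[OF compact_full_shift[OF A]]
    by (metis inf.absorb2)
qed

theorem bounded_radius:
  fixes G H :: "nat labelled_graph"
  assumes G: "vertices_below G m" and labels: "labels_below G m"
    and H: "vertices_below H m'" and hom: "homomorphism (label_sequences G) (label_sequences H) \<phi>"
  shows "\<exists>\<psi>. (\<forall>x\<in>label_sequences G. \<psi> x \<in> label_sequences H) \<and>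
    (\<forall>x\<in>label_sequences G. \<forall>y\<in>label_sequences G. \<forall>i k.
      agree (radius m (gap m m')) x i y k \<longrightarrow> \<psi> x i = \<psi> y k)"
proof -
  define N where "N = gap m m'"
  define l where "l = N * N"
  define K where "K = 2 * l"
  define r where "r = m ^ (2 * K + 1)"
  have N: "2 ^ (m * m) \<le> N" "2 ^ (2 ^ (m' * m')) \<le> N" "1 \<le> N"
    by (simp_all add: N_def gap_def add_increasing)
  let ?S = "{w. set w \<subseteq> {..<m} \<and> length w = 2 * K + 1}"
  have "finite ?S" by (rule finite_lists_length_eq) simp
  moreover have "card ?S = r" unfolding r_def by (subst card_lists_length_eq) simp_all
  ultimately obtain color where color: "bij_betw color ?S {0..<r}"
    using ex_bij_betw_finite_nat by blast
  have color_less: "color w < r" if "set w \<subseteq> {..<m}" "length w = 2 * K + 1" for w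
    using bij_betwE[OF color] that by auto
  obtain R f where f: "\<And>u v. agree R u 0 v 0 \<Longrightarrow> f u = f v"
    "\<And>x i. x \<in> label_sequences G \<Longrightarrow> \<phi> x i = f (\<lambda>j. x (i + j))"
  proof -
    have "\<exists>R f. (\<forall>u v. agree R u 0 v 0 \<longrightarrow> f u = f v) \<and>
        (\<forall>x\<in>label_sequences G. \<forall>i. \<phi> x i = f (\<lambda>j. x (i + j)))"
      using shift_label_sequences[of G] hom
      by (intro block_code_exists compact_label_sequences) (auto simp: homomorphism_def)
    then show ?thesis using that by blast
  qed
  interpret normalization N l K m r color G H m m' R \<phi> f
  proof
    show "N \<le> l" using N(3) by (simp add: l_def)
    show "inj_on color ?S" using color by (rule bij_betw_imp_inj_on)
  qed (use N G H labels f color_less hom in \<open>auto simp: l_def K_def homomorphism_def\<close>)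
  have "radius m (gap m m') = cut_radius + 6 * l"
    by (simp add: radius_def N_def[symmetric] l_def K_def r_def)
  then show ?thesis
    using psi_into psi_local label_range by (intro exI[of _ \<psi>]) simp
qed

section \<open>Block codes on finite paths\<close>

text \<open>
  A block code of width \<open>W\<close> is applied to all windows of a path of length \<open>L + W\<close>.  The paths need not
  be extendable to bi-infinite ones; this keeps the condition finitary.
\<close>

definition block_ok :: "(nat list \<Rightarrow> nat) \<Rightarrow> nat \<Rightarrow> nat \<Rightarrow> nat labelled_graph \<Rightarrow> nat labelled_graph \<Rightarrow> bool" where
  "block_ok F W L G H \<longleftrightarrow> (\<forall>v w. (\<forall>i<L + W. (v i, w i, v (Suc i)) \<in> set G) \<longrightarrow>
    (\<exists>u. \<forall>i<L. (u i, F (map w [i..<i + W]), u (Suc i)) \<in> set H))"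

lemma shift_label_sequence: "x \<in> label_sequences G \<Longrightarrow> (\<lambda>j. x (j + c)) \<in> label_sequences G"
proof -
  assume "x \<in> label_sequences G"
  then obtain v where v: "\<And>i. (v i, x i, v (i + 1)) \<in> set G" by (auto simp: label_sequences_def)
  have "(v (i + c), x (i + c), v (i + 1 + c)) \<in> set G" for i
    using v[of "i + c"] by (simp add: algebra_simps)
  then show ?thesis unfolding label_sequences_def mem_Collect_eq
    by (intro exI[of _ "\<lambda>i. v (i + c)"] allI)
qed

lemma int_mod_step:
  "0 < p \<Longrightarrow> (j + 1) mod p = (if j mod p + 1 = p then 0 else j mod p + 1)" for j p :: int
proof -
  assume p: "0 < p"
  have "(j + 1) mod p = (j mod p + 1) mod p" by (rule mod_add_left_eq[symmetric])
  moreover have "0 \<le> j mod p" "j mod p < p" using p by simp_all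
  ultimately show ?thesis by (auto simp: mod_pos_pos_trivial)
qed

lemma repeated_vertex:
  fixes v :: "nat \<Rightarrow> nat"
  assumes "\<And>i. s \<le> i \<Longrightarrow> i \<le> s + m \<Longrightarrow> v i < m"
  shows "\<exists>a b. s \<le> a \<and> a < b \<and> b \<le> s + m \<and> v a = v b"
proof -
  have "\<not> inj_on v {s..s + m}"
  proof
    assume "inj_on v {s..s + m}"
    then have "card {s..s + m} \<le> card {..<m}" using assms by (intro card_inj_on_le[of v]) auto
    then show False by simp
  qed
  then obtain a b where "a \<in> {s..s + m}" "b \<in> {s..s + m}" "a < b" "v a = v b"
    unfolding inj_on_def by (metis linorder_neqE_nat)
  then show ?thesis by auto
qed

text \<open>
  Among \<open>m + 1\<close> consecutive vertices one is repeated, which closes a cycle.  Running around one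
  such cycle near each end of the path extends everything in between to a bi-infinite path.
\<close>

lemma walk_extends:
  assumes G: "vertices_below G m" and D: "2 * m \<le> D" "1 \<le> D"
    and e: "\<And>i. i < D \<Longrightarrow> (v i, w i, v (Suc i)) \<in> set G"
  shows "\<exists>x\<in>label_sequences G. \<forall>i. m \<le> i \<longrightarrow> i + m < D \<longrightarrow> x (int i) = w i"
proof -
  have v: "v i < m" if "i \<le> D" for i
  proof (cases "i < D")
    case True
    then show ?thesis using e[of i] G by (auto simp: vertices_below_def)
  next
    case False
    then show ?thesis using e[of "D - 1"] that D G by (auto simp: vertices_below_def)
  qed
  obtain a b where ab: "a < b" "b \<le> m" "v a = v b"
    using repeated_vertex[of 0 m v] v D by force
  obtain a' b' where ab': "D - m \<le> a'" "a' < b'" "b' \<le> D" "v a' = v b'"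
    using repeated_vertex[of "D - m" m v] v D by force
  define h where "h k = (if k < int a then a + nat ((k - int a) mod int (b - a))
    else if k < int b' then nat k else a' + nat ((k - int a') mod int (b' - a')))" for k
  have cyc: "v (Suc (s + nat (j mod int (t - s)))) = v (s + nat ((j + 1) mod int (t - s)))"
    if "s < t" "v s = v t" for s t :: nat and j
  proof -
    have p: "0 < int (t - s)" using that by simp
    have n: "0 \<le> j mod int (t - s)" using p by simp
    show ?thesis
    proof (cases "j mod int (t - s) + 1 = int (t - s)")
      case True
      then have "Suc (s + nat (j mod int (t - s))) = t" using n that(1) by linarith
      then show ?thesis using True int_mod_step[OF p, of j] that by simp
    next
      case False
      then have "nat ((j + 1) mod int (t - s)) = Suc (nat (j mod int (t - s)))"
        using n int_mod_step[OF p, of j] by simp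
      then show ?thesis by simp
    qed
  qed
  have rem: "nat (j mod int (t - s)) < t - s" if "s < t" for s t :: nat and j
    using that by (simp add: nat_less_iff)
  have step: "h k < D \<and> v (Suc (h k)) = v (h (k + 1))" for k
  proof -
    consider "k + 1 < int a" | "k + 1 = int a" | "int a \<le> k" "k + 1 < int b'" | "k + 1 = int b'" | "int b' \<le> k"
      using ab ab' by linarith
    then show ?thesis
    proof cases
      case 1
      then have "h k = a + nat ((k - int a) mod int (b - a))" by (simp add: h_def)
      then have "h k < D" using rem[OF ab(1), of "k - int a"] ab D by linarith
      then show ?thesis using 1 cyc[OF ab(1,3), of "k - int a"] by (simp add: h_def algebra_simps)
    next
      case 2
      then have "h k = a + nat ((k - int a) mod int (b - a))" by (simp add: h_def)
      then have "h k < D" using rem[OF ab(1), of "k - int a"] ab D by linarith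
      moreover have "a < b'" using ab ab' D by linarith
      ultimately show ?thesis using 2 cyc[OF ab(1,3), of "k - int a"] by (simp add: h_def algebra_simps)
    next
      case 3
      then show ?thesis using ab ab' by (auto simp: h_def nat_add_distrib)
    next
      case 4
      then have "h k = b' - 1" "h (k + 1) = a'" using ab ab' D by (auto simp: h_def)
      then show ?thesis using ab' by simp
    next
      case 5
      then have late: "\<not> k < int a" "\<not> k + 1 < int a" "\<not> k < int b'" "\<not> k + 1 < int b'"
        using ab ab' D by linarith+
      then have h: "h k = a' + nat ((k - int a') mod int (b' - a'))"
        "h (k + 1) = a' + nat ((k - int a' + 1) mod int (b' - a'))"
        by (simp_all only: h_def if_False) (simp_all add: algebra_simps)
      then have "h k < D" using rem[OF ab'(2), of "k - int a'"] ab' by linarith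
      then show ?thesis using cyc[OF ab'(2,4), of "k - int a'"] unfolding h by blast
    qed
  qed
  have "(v (h k), w (h k), v (h (k + 1))) \<in> set G" for k using e[of "h k"] step[of k] by simp
  then have "(\<lambda>k. w (h k)) \<in> label_sequences G"
    unfolding label_sequences_def mem_Collect_eq by (intro exI[of _ "\<lambda>k. v (h k)"] allI)
  moreover have "h (int i) = i" if "m \<le> i" "i + m < D" for i
    using that ab ab' by (simp add: h_def)
  ultimately show ?thesis by (intro bexI[of _ "\<lambda>k. w (h k)"]) auto
qed

text \<open>
  The width exceeds \<open>2 * B + 1\<close> by \<open>m\<close> on either side: the middle of each window then lies in a part of
  the path that extends to a point, even if the ends of the path do not.
\<close>

lemma block_code_from_local_map:
  assumes G: "vertices_below G m"
    and into: "\<And>x. x \<in> label_sequences G \<Longrightarrow> \<psi> x \<in> label_sequences H"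
    and loc: "\<And>x y i k. x \<in> label_sequences G \<Longrightarrow> y \<in> label_sequences G \<Longrightarrow>
      agree B x i y k \<Longrightarrow> \<psi> x i = \<psi> y k"
  shows "\<exists>F. \<forall>L. block_ok F (2 * (B + m) + 1) L G H"
proof -
  define W where "W = 2 * (B + m) + 1"
  define P where "P ws y \<longleftrightarrow> y \<in> label_sequences G \<and>
    (\<forall>j. \<bar>j\<bar> \<le> int B \<longrightarrow> y j = ws ! nat (int (B + m) + j))" for ws y
  define F where "F ws = \<psi> (SOME y. P ws y) 0" for ws
  have "block_ok F W L G H" for L
    unfolding block_ok_def
  proof (intro allI impI)
    fix v w assume e: "\<forall>i<L + W. (v i, w i, v (Suc i)) \<in> set G"
    obtain x where x: "x \<in> label_sequences G" "\<And>i. m \<le> i \<Longrightarrow> i + m < L + W \<Longrightarrow> x (int i) = w i"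
      using walk_extends[OF G, of "L + W" v w] e by (auto simp: W_def)
    obtain u where u: "\<And>i. (u i, \<psi> x i, u (i + 1)) \<in> set H"
      using into[OF x(1)] by (auto simp: label_sequences_def)
    have "F (map w [i..<i + W]) = \<psi> x (int i + int (B + m))" if i: "i < L" for i
    proof -
      have xw: "x (int i + int (B + m) + j) = map w [i..<i + W] ! nat (int (B + m) + j)"
        if j: "\<bar>j\<bar> \<le> int B" for j
      proof -
        define k where "k = nat (int (B + m) + j)"
        have k: "int k = int (B + m) + j" "m \<le> k" "k + m < W" using j by (auto simp: k_def W_def)
        have "x (int (i + k)) = w (i + k)" using k i by (intro x(2)) linarith+
        moreover have "map w [i..<i + W] ! k = w (i + k)" using k by simp
        moreover have "int i + int (B + m) + j = int (i + k)" using k(1) by simp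
        ultimately show ?thesis unfolding k_def[symmetric] by (simp only:)
      qed
      have "P (map w [i..<i + W]) (\<lambda>j. x (j + (int i + int (B + m))))"
        unfolding P_def
      proof (intro conjI allI impI)
        show "x (j + (int i + int (B + m))) = map w [i..<i + W] ! nat (int (B + m) + j)"
          if "\<bar>j\<bar> \<le> int B" for j
          using xw[OF that] by (simp only: add.commute[of j])
      qed (rule shift_label_sequence[OF x(1)])
      define y where "y = (SOME y. P (map w [i..<i + W]) y)"
      have "P (map w [i..<i + W]) y"
        unfolding y_def by (rule someI[where P = "P (map w [i..<i + W])"]) fact
      then have y: "y \<in> label_sequences G"
        "\<And>j. \<bar>j\<bar> \<le> int B \<Longrightarrow> y j = x (int i + int (B + m) + j)"
        unfolding P_def using xw by simp_all
      show ?thesis unfolding F_def y_def[symmetric]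
        by (rule loc[OF y(1) x(1)]) (use y(2) in \<open>simp add: agree_def\<close>)
    qed
    then show "\<exists>u. \<forall>i<L. (u i, F (map w [i..<i + W]), u (Suc i)) \<in> set H"
      using u[of "int _ + int (B + m)"]
      by (intro exI[of _ "\<lambda>i. u (int i + int (B + m))"]) (simp add: algebra_simps)
  qed
  then show ?thesis unfolding W_def by blast
qed

lemma homomorphism_from_block_code:
  fixes F :: "nat list \<Rightarrow> nat"
  assumes ok: "\<And>L. block_ok F W L G H"
  shows "homomorphism (label_sequences G) (label_sequences H) (\<lambda>x i. F (word x i W))"
  unfolding homomorphism_def
proof (intro conjI ballI)
  show "continuous_on (label_sequences G) (\<lambda>x i. F (word x i W))"
  proof (rule continuous_on_coordinatewise_then_product)
    fix i
    have "continuous_on UNIV (\<lambda>x :: int \<Rightarrow> nat. F (word x i W))"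
      unfolding continuous_on_open_vimage[OF open_UNIV]
    proof (intro allI impI)
      fix B :: "nat set" assume "open B"
      have "open (\<Inter>j\<in>{..<W}. (\<lambda>x :: int \<Rightarrow> nat. x (i + int j)) -` {y (i + int j)})" for y
        by (intro open_INT ballI open_vimage)
          (auto simp: open_discrete continuous_on_product_coordinates)
      moreover have "(\<lambda>x. F (word x i W)) -` B \<inter> UNIV =
          (\<Union>y\<in>{y. F (word y i W) \<in> B}. \<Inter>j\<in>{..<W}. (\<lambda>x :: int \<Rightarrow> nat. x (i + int j)) -` {y (i + int j)})"
      proof (intro equalityI subsetI)
        fix x assume "x \<in> (\<Union>y\<in>{y. F (word y i W) \<in> B}. \<Inter>j\<in>{..<W}. (\<lambda>x :: int \<Rightarrow> nat. x (i + int j)) -` {y (i + int j)})"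
        then obtain y where y: "F (word y i W) \<in> B" "\<And>j. j < W \<Longrightarrow> x (i + int j) = y (i + int j)" by auto
        then have "word x i W = word y i W" by (intro word_cong) simp
        then show "x \<in> (\<lambda>x. F (word x i W)) -` B \<inter> UNIV" using y by simp
      qed auto
      ultimately show "open ((\<lambda>x. F (word x i W)) -` B \<inter> UNIV)" by (simp only:) (intro open_UN ballI)
    qed
    then show "continuous_on (label_sequences G) (\<lambda>x. F (word x i W))"
      by (rule continuous_on_subset) simp
  qed
  show "(\<lambda>x i. F (word x i W)) ` label_sequences G \<subseteq> label_sequences H"
  proof
    fix z assume "z \<in> (\<lambda>x i. F (word x i W)) ` label_sequences G"
    then obtain x where x: "x \<in> label_sequences G" and z: "z = (\<lambda>i. F (word x i W))" by blast
    obtain v where v: "\<And>i. (v i, x i, v (i + 1)) \<in> set G" using x by (auto simp: label_sequences_def)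
    show "z \<in> label_sequences H"
    proof (rule label_sequence_if_finite_words)
      fix d
      let ?v = "\<lambda>i. v (int i - int d)" and ?w = "\<lambda>i. x (int i - int d)"
      have "(?v i, ?w i, ?v (Suc i)) \<in> set G" for i using v[of "int i - int d"] by (simp add: algebra_simps)
      then have "\<exists>u. \<forall>i<2 * d. (u i, F (map ?w [i..<i + W]), u (Suc i)) \<in> set H"
        using ok[of "2 * d", unfolded block_ok_def, rule_format, of ?v ?w] by blast
      then obtain u where u: "\<And>i. i < 2 * d \<Longrightarrow> (u i, F (map ?w [i..<i + W]), u (Suc i)) \<in> set H"
        by blast
      have "map ?w [i..<i + W] = word x (- int d + int i) W" for i
        by (rule nth_equalityI) (simp_all add: algebra_simps)
      then have "walk H (u 0) (word z (- int d) (2 * d)) (u (2 * d))"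
        unfolding walk_word z using u by (intro exI[of _ u]) simp
      then show "\<exists>p q. walk H p (word z (- int d) (2 * d)) q" by blast
    qed
  qed
  fix x :: "int \<Rightarrow> nat"
  have "word (\<lambda>i. x (i + 1)) i W = word x (i + 1) W" for i
    by (rule nth_equalityI) (simp_all add: algebra_simps)
  then show "(\<lambda>i. F (word (shift x) i W)) = shift (\<lambda>i. F (word x i W))"
    by (simp add: shift_def)
qed

text \<open>
  The subset construction: the vertices at which some path labelled by \<open>a 0, \<dots>, a (i - 1)\<close> ends.
\<close>

fun reach :: "nat labelled_graph \<Rightarrow> nat \<Rightarrow> (nat \<Rightarrow> nat) \<Rightarrow> nat \<Rightarrow> nat set" where
  "reach H m a 0 = {..<m}"
| "reach H m a (Suc i) = {q. \<exists>p\<in>reach H m a i. (p, a i, q) \<in> set H}"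

lemma reach_iff:
  assumes H: "vertices_below H m" and m: "0 < m"
  shows "reach H m a L \<noteq> {} \<longleftrightarrow> (\<exists>u. \<forall>i<L. (u i, a i, u (Suc i)) \<in> set H)"
proof
  assume "reach H m a L \<noteq> {}"
  then obtain q where "q \<in> reach H m a L" by blast
  then have "\<exists>u. u L = q \<and> (\<forall>i<L. (u i, a i, u (Suc i)) \<in> set H)"
  proof (induction L arbitrary: q)
    case (Suc L)
    then obtain p where p: "p \<in> reach H m a L" "(p, a L, q) \<in> set H" by auto
    obtain u where "u L = p" "\<forall>i<L. (u i, a i, u (Suc i)) \<in> set H" using Suc.IH[OF p(1)] by blast
    then show ?case using p by (intro exI[of _ "u(Suc L := q)"]) (auto simp: less_Suc_eq)
  qed auto
  then show "\<exists>u. \<forall>i<L. (u i, a i, u (Suc i)) \<in> set H" by blast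
next
  assume "\<exists>u. \<forall>i<L. (u i, a i, u (Suc i)) \<in> set H"
  then obtain u where u: "\<And>i. i < L \<Longrightarrow> (u i, a i, u (Suc i)) \<in> set H" by blast
  show "reach H m a L \<noteq> {}"
  proof (cases L)
    case 0
    then show ?thesis using m by auto
  next
    case (Suc k)
    have "i \<le> L \<Longrightarrow> u i \<in> reach H m a i" for i
    proof (induction i)
      case 0
      then show ?case using u[of 0] Suc H by (auto simp: vertices_below_def)
    next
      case (Suc i)
      then show ?case using u[of i] by auto
    qed
    then show ?thesis by blast
  qed
qed

lemma reach_subset: "vertices_below H m \<Longrightarrow> reach H m a i \<subseteq> {..<m}"
  by (cases i) (auto simp: vertices_below_def)

text \<open>
  Consider the vertex after the \<open>i\<close>-th window, the window itself, and the set \<open>reach\<close> of the outputs so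
  far.  There are at most \<open>m * m ^ W * 2 ^ m'\<close> such triples.  A longer counterexample repeats one of
  them, and cutting out the part in between gives a shorter counterexample.
\<close>

lemma block_ok_if_short:
  assumes G: "vertices_below G m" and labels: "labels_below G m"
    and H: "vertices_below H m'" and m': "0 < m'" and W: "0 < W"
    and short: "\<And>L. L \<le> m * m ^ W * 2 ^ m' \<Longrightarrow> block_ok F W L G H"
  shows "block_ok F W L G H"
proof (induction L rule: less_induct)
  case (less L)
  let ?Q = "m * m ^ W * 2 ^ m'"
  show ?case
  proof (cases "L \<le> ?Q")
    case False
    show ?thesis unfolding block_ok_def
    proof (intro allI impI)
      fix v w assume e: "\<forall>i<L + W. (v i, w i, v (Suc i)) \<in> set G"
      define a where "a i = F (map w [i..<i + W])" for i
      define st where "st i = (v (i + W), map w [i..<i + W], reach H m' a i)" for i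
      let ?S = "{..<m} \<times> {ws. set ws \<subseteq> {..<m} \<and> length ws = W} \<times> Pow {..<m'}"
      have card: "card ?S = ?Q"
        by (simp add: card_cartesian_product card_Pow card_lists_length_eq)
      have "finite ?S" by (intro finite_cartesian_product finite_lists_length_eq) simp_all
      have st: "st i \<in> ?S" if "i \<le> ?Q" for i
      proof -
        have i: "i < L" using that False by simp
        have "w k < m" if "k < i + W" for k 
          using e[rule_format, of k] labels i that by (auto simp: labels_below_def)
        moreover have "v (i + W) < m"
          using e[rule_format, of "i + W"] G i by (auto simp: vertices_below_def)
        ultimately show ?thesis using reach_subset[OF H] by (auto simp: st_def)
      qed
      have "\<not> inj_on st {..?Q}"
      proof
        assume "inj_on st {..?Q}"
        then have "card {..?Q} \<le> card ?S"
          using st \<open>finite ?S\<close> by (intro card_inj_on_le[of st] image_subsetI) simp_all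
        then show False unfolding card by simp
      qed
      then obtain i j where ij: "i < j" "j \<le> ?Q" "st i = st j"
        unfolding inj_on_def by (metis atMost_iff linorder_neqE_nat)
      define d where "d = j - i"
      have d: "0 < d" "j = i + d" "d \<le> L" "j < L" using ij False by (auto simp: d_def)
      define v' where "v' k = (if k \<le> i + W then v k else v (k + d))" for k
      define w' where "w' k = (if k < i then w k else w (k + d))" for k
      \<comment> \<open>Since the states at \<open>i\<close> and \<open>j\<close> coincide, both descriptions of the spliced path are valid on their overlap.\<close>
      have v'_late: "v' k = v (k + d)" if "i + W \<le> k" for k
        using that ij(3) d(2) by (cases "k = i + W") (auto simp: v'_def st_def algebra_simps)
      have w'_early: "w' k = w k" if "k < i + W" for k
      proof (cases "k < i")
        case False
        have "map w [i..<i + W] ! (k - i) = map w [j..<j + W] ! (k - i)" using ij(3) by (simp add: st_def)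
        then show ?thesis using False that d(2) by (simp add: w'_def algebra_simps)
      qed (simp add: w'_def)
      have e': "(v' k, w' k, v' (Suc k)) \<in> set G" if "k < (L - d) + W" for k
      proof (cases "k < i + W")
        case True
        then show ?thesis using w'_early[OF True] e that by (simp add: v'_def)
      next
        case False
        then show ?thesis using v'_late[of k] v'_late[of "Suc k"] e that d by (simp add: w'_def)
      qed
      define a' where "a' k = F (map w' [k..<k + W])" for k
      have a'_early: "a' k = a k" if "k < i" for k
      proof -
        have "map w' [k..<k + W] = map w [k..<k + W]" using that by (auto intro: w'_early)
        then show ?thesis by (simp only: a'_def a_def)
      qed
      have a'_late: "a' k = a (k + d)" if "i \<le> k" for k
      proof -
        have "map w' [k..<k + W] = map w [k + d..<k + d + W]"
          using that by (intro nth_equalityI) (auto simp: w'_def algebra_simps)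
        then show ?thesis by (simp only: a'_def a_def)
      qed
      have r1: "reach H m' a' k = reach H m' a k" if "k \<le> i" for k
        using that by (induction k) (auto simp: a'_early)
      have r2: "reach H m' a' (i + k) = reach H m' a (j + k)" for k
      proof (induction k)
        case 0
        then show ?case using r1[of i] ij(3) by (simp add: st_def)
      next
        case (Suc k)
        then show ?case using a'_late[of "i + k"] d(2) by (simp add: algebra_simps)
      qed
      have "\<exists>u. \<forall>k<L - d. (u k, a' k, u (Suc k)) \<in> set H"
        unfolding a'_def using d e'
        by (intro less[of "L - d", unfolded block_ok_def, rule_format]) simp_all
      then have "reach H m' a' (L - d) \<noteq> {}" unfolding reach_iff[OF H m'] .
      moreover have "L - d = i + (L - j)" "j + (L - j) = L" using d by simp_all
      ultimately have "reach H m' a L \<noteq> {}" using r2[of "L - j"] by simp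
      then show "\<exists>u. \<forall>k<L. (u k, F (map w [k..<k + W]), u (Suc k)) \<in> set H"
        unfolding reach_iff[OF H m'] a_def .
    qed
  qed (rule short)
qed

section \<open>The decision procedure\<close>

lemma digits_unique:
  "a < m ^ L \<Longrightarrow> b < m ^ L \<Longrightarrow> (\<And>i. i < L \<Longrightarrow> dig m a i = dig m b i) \<Longrightarrow> a = b"
proof (induction L arbitrary: a b)
  case (Suc L)
  have "a div m = b div m"
  proof (rule Suc.IH)
    show "a div m < m ^ L" "b div m < m ^ L"
      using Suc.prems(1,2) by (simp_all add: less_mult_imp_div_less mult.commute)
    show "dig m (a div m) i = dig m (b div m) i" if "i < L" for i
      using Suc.prems(3)[of "Suc i"] that dig_div[of m _ 1] by simp
  qed
  moreover have "a mod m = b mod m" using Suc.prems(3)[of 0] by (simp add: dig_def)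
  ultimately show ?case by (metis div_mult_mod_eq)
qed simp

text \<open>
  The condition \<open>block_ok\<close> in digits.  The number \<open>c\<close> is the table of the block code: its digit at
  place \<open>k\<close> is the value at the window with number \<open>k\<close>, and \<open>(w div m ^ i) mod m ^ W\<close> is the number of
  the \<open>i\<close>-th window of \<open>w\<close>.
\<close>

definition table_ok :: "nat \<Rightarrow> nat \<Rightarrow> nat \<Rightarrow> nat \<Rightarrow> nat \<Rightarrow> (nat \<times> nat \<times> nat) set \<Rightarrow> (nat \<times> nat \<times> nat) set \<Rightarrow> bool" where
  "table_ok m m' W c L EG EH \<longleftrightarrow>
    (\<forall>v<m ^ (L + W + 1). \<forall>w<m ^ (L + W).
      (\<forall>i<L + W. (dig m v i, dig m w i, dig m v (i + 1)) \<in> EG) \<longrightarrow>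
      (\<exists>u<m' ^ (L + 1). \<forall>i<L.
        (dig m' u i, dig m' c ((w div m ^ i) mod m ^ W), dig m' u (i + 1)) \<in> EH))"

lemma vertices_as_digits:
  assumes H: "vertices_below H m" and m: "0 < m" and u: "\<And>i. i < L \<Longrightarrow> (u i, a i, u (Suc i)) \<in> set H"
  shows "\<exists>k<m ^ (L + 1). \<forall>i<L. dig m k i = u i \<and> dig m k (Suc i) = u (Suc i)"
proof -
  have "\<exists>k<m ^ (L + 1). \<forall>i<L + 1. dig m k i = (if u i < m then u i else 0)"
    by (rule digits_exist) (use m in simp)
  moreover have "u i < m" "u (Suc i) < m" if "i < L" for i
    using u[OF that] H by (auto simp: vertices_below_def)
  ultimately show ?thesis by (metis (no_types, lifting) add.commute less_SucI not_less_eq plus_1_eq_Suc)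
qed

lemma table_ok_iff:
  assumes G: "vertices_below G m" and labels: "labels_below G m"
    and H: "vertices_below H m'" and m: "0 < m" "0 < m'"
    and F: "\<And>k. k < m ^ W \<Longrightarrow> dig m' c k = F (map (dig m k) [0..<W])"
  shows "table_ok m m' W c L (set G) (set H) \<longleftrightarrow> block_ok F W L G H"
proof -
  have window: "dig m' c ((w div m ^ i) mod m ^ W) = F (map (dig m w) [i..<i + W])" for w i
  proof -
    have "map (dig m ((w div m ^ i) mod m ^ W)) [0..<W] = map (dig m w) [i..<i + W]"
      by (rule nth_equalityI) (simp_all add: dig_mod dig_div)
    moreover have "(w div m ^ i) mod m ^ W < m ^ W" using m by simp
    ultimately show ?thesis using F by simp
  qed
  show ?thesis
  proof
    assume ok: "table_ok m m' W c L (set G) (set H)"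
    show "block_ok F W L G H" unfolding block_ok_def
    proof (intro allI impI)
      fix v w assume e: "\<forall>i<L + W. (v i, w i, v (Suc i)) \<in> set G"
      obtain v' where v': "v' < m ^ (L + W + 1)"
        "\<And>i. i < L + W \<Longrightarrow> dig m v' i = v i \<and> dig m v' (Suc i) = v (Suc i)"
        using vertices_as_digits[OF G m(1), of "L + W" v w] e by blast
      obtain w' where w': "w' < m ^ (L + W)" "\<And>i. i < L + W \<Longrightarrow> dig m w' i = w i"
        using digits_exist[of "L + W" w m] e labels by (fastforce simp: labels_below_def)
      have "\<forall>i<L + W. (dig m v' i, dig m w' i, dig m v' (i + 1)) \<in> set G"
        using e v'(2) w'(2) by simp
      then obtain u where u: "\<And>i. i < L \<Longrightarrow>
          (dig m' u i, dig m' c ((w' div m ^ i) mod m ^ W), dig m' u (i + 1)) \<in> set H"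
        using ok v'(1) w'(1) unfolding table_ok_def by blast
      have "map (dig m w') [i..<i + W] = map w [i..<i + W]" if "i < L" for i
        using that w'(2) by auto
      then have "(dig m' u i, F (map w [i..<i + W]), dig m' u (Suc i)) \<in> set H" if "i < L" for i
        using u[OF that] that by (simp only: window Suc_eq_plus1)
      then show "\<exists>u. \<forall>i<L. (u i, F (map w [i..<i + W]), u (Suc i)) \<in> set H"
        by blast
    qed
  next
    assume ok: "block_ok F W L G H"
    show "table_ok m m' W c L (set G) (set H)" unfolding table_ok_def
    proof (intro allI impI)
      fix v w assume "\<forall>i<L + W. (dig m v i, dig m w i, dig m v (i + 1)) \<in> set G"
      then obtain u where u: "\<And>i. i < L \<Longrightarrow> (u i, F (map (dig m w) [i..<i + W]), u (Suc i)) \<in> set H"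
        using ok unfolding block_ok_def by (metis Suc_eq_plus1)
      obtain u' where "u' < m' ^ (L + 1)"
        "\<And>i. i < L \<Longrightarrow> dig m' u' i = u i \<and> dig m' u' (Suc i) = u (Suc i)"
        using vertices_as_digits[OF H m(2), of L u "\<lambda>i. F (map (dig m w) [i..<i + W])"] u by blast
      then show "\<exists>u<m' ^ (L + 1). \<forall>i<L.
          (dig m' u i, dig m' c ((w div m ^ i) mod m ^ W), dig m' u (i + 1)) \<in> set H"
        using u by (intro exI[of _ u']) (simp add: window)
    qed
  qed
qed

definition width :: "nat \<Rightarrow> nat \<Rightarrow> nat" where
  "width m m' = 2 * (radius m (gap m m') + m) + 1"

lemma homomorphism_iff_table:
  fixes G H :: "nat labelled_graph"
  assumes G: "vertices_below G m" and labels: "labels_below G m"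
    and H: "vertices_below H m'" and labels': "labels_below H m'"
    and m: "0 < m" "0 < m'" and W: "W = width m m'"
  shows "(\<exists>\<phi>. homomorphism (label_sequences G) (label_sequences H) \<phi>) \<longleftrightarrow>
    (\<exists>c<m' ^ (m ^ W). \<forall>L<m * m ^ W * 2 ^ m' + 1. table_ok m m' W c L (set G) (set H))"
proof
  assume "\<exists>\<phi>. homomorphism (label_sequences G) (label_sequences H) \<phi>"
  then obtain \<phi> where "homomorphism (label_sequences G) (label_sequences H) \<phi>" by blast
  from bounded_radius[OF G labels H this] obtain \<psi> where
    \<psi>: "\<And>x. x \<in> label_sequences G \<Longrightarrow> \<psi> x \<in> label_sequences H"
    "\<And>x y i k. x \<in> label_sequences G \<Longrightarrow> y \<in> label_sequences G \<Longrightarrow>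
      agree (radius m (gap m m')) x i y k \<Longrightarrow> \<psi> x i = \<psi> y k" by blast
  have "\<exists>F. \<forall>L. block_ok F (2 * (radius m (gap m m') + m) + 1) L G H"
    by (rule block_code_from_local_map[OF G]) (fact \<psi>)+
  then obtain F where F: "\<And>L. block_ok F W L G H"
    unfolding W width_def by blast
  define F' where "F' ws = (if F ws < m' then F ws else 0)" for ws
  have F': "block_ok F' W L G H" for L
    unfolding block_ok_def
  proof (intro allI impI)
    fix v w assume "\<forall>i<L + W. (v i, w i, v (Suc i)) \<in> set G"
    then obtain u where "\<And>i. i < L \<Longrightarrow> (u i, F (map w [i..<i + W]), u (Suc i)) \<in> set H"
      using F[of L] unfolding block_ok_def by blast
    then show "\<exists>u. \<forall>i<L. (u i, F' (map w [i..<i + W]), u (Suc i)) \<in> set H"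
      using labels' by (intro exI[of _ u]) (fastforce simp: F'_def labels_below_def)
  qed
  have "\<exists>c<m' ^ (m ^ W). \<forall>k<m ^ W. dig m' c k = F' (map (dig m k) [0..<W])"
    by (rule digits_exist) (simp add: F'_def m)
  then show "\<exists>c<m' ^ (m ^ W). \<forall>L<m * m ^ W * 2 ^ m' + 1. table_ok m m' W c L (set G) (set H)"
    using table_ok_iff[OF G labels H m] F' by metis
next
  assume "\<exists>c<m' ^ (m ^ W). \<forall>L<m * m ^ W * 2 ^ m' + 1. table_ok m m' W c L (set G) (set H)"
  then obtain c where c: "\<And>L. L \<le> m * m ^ W * 2 ^ m' \<Longrightarrow> table_ok m m' W c L (set G) (set H)"
    using less_add_one order_le_less_trans by blast
  define F where "F ws = dig m' c (THE k. k < m ^ W \<and> map (dig m k) [0..<W] = ws)" for ws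
  have F: "dig m' c k = F (map (dig m k) [0..<W])" if "k < m ^ W" for k
  proof -
    have "(THE k'. k' < m ^ W \<and> map (dig m k') [0..<W] = map (dig m k) [0..<W]) = k"
    proof (rule the_equality)
      fix k' assume k': "k' < m ^ W \<and> map (dig m k') [0..<W] = map (dig m k) [0..<W]"
      have "dig m k' i = dig m k i" if "i < W" for i
      proof -
        have "map (dig m k') [0..<W] ! i = map (dig m k) [0..<W] ! i" by (simp only: k')
        then show ?thesis using that by simp
      qed
      with conjunct1[OF k'] that show "k' = k" by (rule digits_unique)
    qed (use that in simp)
    then show ?thesis by (simp add: F_def)
  qed
  have "block_ok F W L G H" for L
  proof (rule block_ok_if_short[OF G labels H m(2)])
    show "0 < W" by (simp add: W width_def)
    show "block_ok F W L G H" if "L \<le> m * m ^ W * 2 ^ m'" for L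
      using c[OF that] table_ok_iff[OF G labels H m F] by blast
  qed
  then show "\<exists>\<phi>. homomorphism (label_sequences G) (label_sequences H) \<phi>"
    using homomorphism_from_block_code by blast
qed

text \<open>
  In \<open>RadiusT\<close> the arguments are \<open>m\<close> and the separation \<open>N\<close>, in \<open>GapT\<close> and \<open>WidthT\<close> they are \<open>m\<close> and \<open>m'\<close>.
\<close>

definition "GapT = Add (PowT (Num 2) (Mul (Var 0) (Var 0))) (PowT (Num 2) (PowT (Num 2) (Mul (Var 1) (Var 1))))"

definition "RadiusT =
  (let s = Mul (Var 1) (Var 1) in
   Add (Add (Mul (Num 2) s) (Mul (Var 1) (PowT (Var 0) (Add (Mul (Num 2) (Mul (Num 2) s)) (Num 1)))))
     (Mul (Num 7) s))"

definition "WidthT = Add (Mul (Num 2) (Add (Call RadiusT [Var 0, GapT]) (Var 0))) (Num 1)"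

lemma ev_WidthT [simp]: "ev WidthT [m, m'] = width m m'"
  by (simp add: WidthT_def RadiusT_def GapT_def width_def radius_def gap_def Let_def)

text \<open>
  The environment is \<open>[L, c, m, m', W, g, g']\<close>.  The binders put \<open>v\<close> and \<open>w\<close> in front of it, then \<open>i\<close> in
  the hypothesis, and \<open>u\<close> and \<open>i\<close> in the conclusion.
\<close>

definition "TableT =
  Prod (PowT (Var 2) (Add (Add (Var 0) (Var 4)) (Num 1)))
   (Prod (PowT (Var 3) (Add (Var 1) (Var 5)))
    (ImpT
     (Prod (Add (Var 2) (Var 6))
       (EdgeT (Var 8) (DigT (Var 5) (Var 2) (Var 0)) (DigT (Var 5) (Var 1) (Var 0))
         (DigT (Var 5) (Var 2) (Add (Var 0) (Num 1)))))
     (Sum (PowT (Var 5) (Add (Var 2) (Num 1)))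
      (Prod (Var 3)
       (EdgeT (Var 10) (DigT (Var 7) (Var 1) (Var 0))
         (DigT (Var 7) (Var 5) (ModT (DivT (Var 2) (PowT (Var 6) (Var 0))) (PowT (Var 6) (Var 8))))
         (DigT (Var 7) (Var 1) (Add (Var 0) (Num 1))))))))"

lemma holds_TableT:
  assumes "0 < m" "0 < m'"
  shows "holds TableT [L, c, m, m', W, g, g'] \<longleftrightarrow> table_ok m m' W c L (edges_of g) (edges_of g')"
  using assms by (simp add: TableT_def table_ok_def)

text \<open>
  The inner environments are \<open>[m, m', g, g']\<close> and \<open>[m, m', W, g, g']\<close>, with one more than the code of a
  graph as bound for its vertices and labels.
\<close>

definition "CritT = Call
  (Call
    (Sum (PowT (Var 1) (PowT (Var 0) (Var 2)))
      (Prod (Add (Mul (Mul (Var 1) (PowT (Var 1) (Var 3))) (PowT (Num 2) (Var 2))) (Num 1)) TableT))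
    [Var 0, Var 1, Call WidthT [Var 0, Var 1], Var 2, Var 3])
  [Add (Var 0) (Num 1), Add (Var 1) (Num 1), Var 0, Var 1]"

lemma holds_CritT:
  "holds CritT [g, g'] \<longleftrightarrow> (let m = g + 1; m' = g' + 1; W = width m m' in
    \<exists>c<m' ^ (m ^ W). \<forall>L<m * m ^ W * 2 ^ m' + 1. table_ok m m' W c L (edges_of g) (edges_of g'))"
  by (simp add: CritT_def holds_TableT Let_def)

lemma wf_CritT: "wf_etm 2 (NotT (NotT CritT))"
  by (simp add: CritT_def TableT_def WidthT_def RadiusT_def GapT_def Let_def)

theorem mainTheorem2:
  shows "\<exists>algorithm. \<forall>(A :: nat set) X G (A' :: nat set) X' G'.
    sofic A X \<and> topologically_transitive X \<and> finite_presentation A G X \<and>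
    sofic A' X' \<and> topologically_transitive X' \<and> finite_presentation A' G' X' \<longrightarrow>
    computes algorithm [graph_encode G, graph_encode G']
      (if \<exists>\<phi>. homomorphism X X' \<phi> then 1 else 0)"
proof -
  obtain p where p: "\<And>xs. length xs = 2 \<Longrightarrow> computes p xs (ev (NotT (NotT CritT)) xs)"
    using computable_ev[OF wf_CritT] unfolding computable_def by blast
  have "computes p [graph_encode G, graph_encode H]
      (if \<exists>\<phi>. homomorphism (label_sequences G) (label_sequences H) \<phi> then 1 else 0)" for G H
  proof -
    have below: "vertices_below G (graph_encode G + 1)" for G
      using edge_less_graph_encode[of _ _ _ G] by (auto simp: vertices_below_def less_Suc_eq)
    have labels: "labels_below G (graph_encode G + 1)" for G
      using edge_less_graph_encode[of _ _ _ G] by (auto simp: labels_below_def less_Suc_eq)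
    have "(\<exists>\<phi>. homomorphism (label_sequences G) (label_sequences H) \<phi>) \<longleftrightarrow>
        holds CritT [graph_encode G, graph_encode H]"
      unfolding holds_CritT Let_def edges_of_graph_encode
      by (rule homomorphism_iff_table[OF below labels below labels]) simp_all
    moreover have "ev (NotT (NotT CritT)) xs = (if holds CritT xs then 1 else 0)" for xs
      by (simp add: ev_NotT)
    ultimately show ?thesis using p[of "[graph_encode G, graph_encode H]"] by simp
  qed
  then show ?thesis unfolding finite_presentation_def by blast
qed

end
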